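(* Let $d\ge 1$, let $p=p_d=\frac{2d+1}{4d}$, and let $(S_n)$ be the $d$-dimensional elephant random walk with memory parameter $p$ described in the context. Then $$\frac{1}{\sqrt{n\log n}}S_n\xrightarrow{\ \mathcal{L}\ }\mathcal{N}\Bigl(0,\frac1d I_d\Bigr),$$ where $\xrightarrow{\mathcal L}$ denotes convergence in distribution.
   Context: Multi-dimensional elephant random walk (MERW). Fix a dimension $d\ge1$ and a memory parameter $p\in[0,1]$. Let $(e_1,\dots,e_d)$ be the standard basis of $\mathbb{R}^d$, $I_d$ the $d\times d$ identity matrix, and $J_d$ the $d\times d$ cyclic permutation matrix with entries $(J_d)_{i,i+1}=1$ for $1\le i\le d-1$, $(J_d)_{d,1}=1$, and all other entries $0$. Set $S_0=0$. The first step $X_1$ is uniformly distributed on $\{\pm e_1,\dots,\pm e_d\}$. For $n\ge1$, given $\mathcal{F}_n=\sigma(X_1,\dots,X_n)$, $X_{n+1}=A_nX_{b_n}$, where $b_n$ is uniform on $\{1,\dots,n\}$ and $A_n$ is a random matrix, with $b_n$, $A_n$ independent of each other and of $\mathcal{F}_n$, equal to $I_d$ with probability $p$ and to each of $-I_d,\ \pm J_d,\dots,\pm J_d^{d-1}$ with probability $\frac{1-p}{2d-1}$. The position is $S_n=X_1+\dots+X_n$. *)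

theory Defs
  imports "HOL-Probability.Probability"
begin

text \<open>Coordinates of real^'d are labelled 0..d-1 through a fixed bijection
  (any labelling gives the same statement up to relabelling of axes).\<close>

definition coord :: "nat \<Rightarrow> 'd::finite" where
  "coord = (SOME f. bij_betw f {0..<CARD('d)} (UNIV :: 'd set))"

definition coord_idx :: "'d::finite \<Rightarrow> nat" where
  "coord_idx = the_inv_into {0..<CARD('d)} coord"

definition basis_vec :: "'d::finite \<Rightarrow> real^'d" where
  "basis_vec i = (\<chi> j. if j = i then 1 else 0)"

definition cyc_J :: "real^'d^'d::finite" where
  "cyc_J = (\<chi> i j. if coord_idx j = (coord_idx i + 1) mod CARD('d) then 1 else 0)"

definition mat_pow :: "real^'d^'d::finite \<Rightarrow> nat \<Rightarrow> real^'d^'d" where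
  "mat_pow A k = ((\<lambda>B. B ** A) ^^ k) (mat 1)"

text \<open>The list -I, J, ..., J^(d-1), -J, ..., -J^(d-1) (2d-1 matrices), indexed by 0..2d-2.\<close>
definition other_mat :: "nat \<Rightarrow> real^'d^'d::finite" where
  "other_mat j = (if j = 0 then - mat 1
                  else if j < CARD('d) then mat_pow cyc_J j
                  else - mat_pow cyc_J (j - CARD('d) + 1))"

definition A_pmf :: "real \<Rightarrow> (real^'d^'d::finite) pmf" where
  "A_pmf p = do {
      keep \<leftarrow> bernoulli_pmf p;
      if keep then return_pmf (mat 1)
      else map_pmf other_mat (pmf_of_set {0..<2 * CARD('d) - 1}) }"

fun merw_steps :: "real \<Rightarrow> nat \<Rightarrow> (real^'d::finite) list pmf" where
  "merw_steps p 0 = return_pmf []"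
| "merw_steps p (Suc 0) =
     map_pmf (\<lambda>x. [x]) (pmf_of_set ((basis_vec ` UNIV) \<union> ((\<lambda>i. - basis_vec i) ` UNIV)))"
| "merw_steps p (Suc (Suc n)) = do {
      xs \<leftarrow> merw_steps p (Suc n);
      b \<leftarrow> pmf_of_set {0..<Suc n};
      A \<leftarrow> A_pmf p;
      return_pmf (xs @ [A *v (xs ! b)]) }"

definition merw_pos :: "real \<Rightarrow> nat \<Rightarrow> (real^'d::finite) pmf" where
  "merw_pos p n = map_pmf sum_list (merw_steps p n)"

definition gauss_iso :: "real \<Rightarrow> (real^'d::finite) measure" where
  "gauss_iso s = density lborel (\<lambda>x. ennreal (\<Prod>i\<in>UNIV. normal_density 0 s (x $ i)))"

definition conv_distr :: "(nat \<Rightarrow> ('a::euclidean_space) measure) \<Rightarrow> 'a measure \<Rightarrow> bool" where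
  "conv_distr M N \<longleftrightarrow>
     (\<forall>f :: 'a \<Rightarrow> real. continuous_on UNIV f \<and> bounded (range f) \<longrightarrow>
        (\<lambda>n. integral\<^sup>L (M n) f) \<longlonglongrightarrow> integral\<^sup>L N f)"

end

theory Submission
  imports Defs
begin

text \<open>At the critical parameter the next step is, with probability 1/2, a uniformly chosen past step
  and, with probability 1/2, a fresh uniform step. Put
  \<open>\<phi>\<^sub>n(v) = E exp(i v\<cdot>S\<^sub>n / \<surd>n)\<close>. Conditioning on the past and expanding to
  second order gives
  \<open>\<phi>\<^sub>n\<^sub>+\<^sub>1(v) = exp(- |v|\<^sup>2 (ln(n+1) - ln n) / (2d)) \<phi>\<^sub>n(v) + O(|v| n\<^bsup>-5/4\<^esup>)\<close>
  for \<open>|v| \<le> 1\<close>: the drift of \<open>S\<^sub>n / \<surd>n\<close> cancels up to \<open>O(n\<^bsup>-3/2\<^esup>)\<close>, and the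
  conditional covariance of the step is \<open>I/d\<close> up to quantities whose second moments are
  \<open>O(n log n)\<close>. The errors are summable, so \<open>\<phi>\<^sub>n(v) = exp(- |v|\<^sup>2 ln n / (2d)) + O(|v|)\<close>
  uniformly in \<open>n\<close>; taking \<open>v = u / \<surd>(ln n)\<close> yields convergence of the characteristic
  functions. With tightness from second moments, weak convergence follows by
  approximating test functions by trigonometric polynomials.\<close>

section \<open>Continuity theorem for tight sequences on Euclidean space\<close>

text \<open>The vector v stays fixed along the recursion and becomes u / sqrt (ln n) only at the
  end. The accumulated error is bounded by a convergent series but does not shrink with n, so
  smallness must come from v: every error term, including the one at time 1, has to keep a factor
  |v|. Restricting to |v| \<le> 1 lets higher powers be replaced by |v|. The scale sqrt n is the one
  at which the drift is neutral: the conditional mean of the next step is S_n/(2n), and (1 + 1/(2n))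
  sqrt n agrees with sqrt (n+1) to first order. What remains at time n is a scaled step with
  covariance about I/(dn), and the harmonic sum of these is the source of log n. The fresh half of
  the step law comes from symmetry: the 2d matrices +-J^k carry any unit step to every unit step
  exactly once, so the part of A_n that is uniform on this group forgets the past
  completely.\<close>

inductive trig_poly :: "('a::euclidean_space \<Rightarrow> complex) \<Rightarrow> bool" where
  monomial: "trig_poly (\<lambda>x. c * iexp (u \<bullet> x))"
| add: "trig_poly f \<Longrightarrow> trig_poly g \<Longrightarrow> trig_poly (\<lambda>x. f x + g x)"

lemma trig_poly_const: "trig_poly (\<lambda>x. c)"
  using trig_poly.monomial[of c 0] by simp

lemma trig_poly_sum:
  assumes "finite A" "\<And>a. a \<in> A \<Longrightarrow> trig_poly (f a)"
  shows "trig_poly (\<lambda>x. \<Sum>a\<in>A. f a x)"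
  using assms by (induction A rule: finite_induct) (auto intro: trig_poly_const trig_poly.add)

lemma trig_poly_mult:
  assumes "trig_poly f" "trig_poly g"
  shows "trig_poly (\<lambda>x. f x * g x)"
  using assms(1)
proof induction
  case (monomial c u)
  show ?case using assms(2)
  proof induction
    case (monomial c' v)
    have "(\<lambda>x. c * iexp (u \<bullet> x) * (c' * iexp (v \<bullet> x))) = (\<lambda>x. (c * c') * iexp ((u + v) \<bullet> x))"
      by (auto simp: inner_add_left exp_add algebra_simps)
    then show ?case by (simp only: trig_poly.monomial)
  next
    case (add f g)
    then show ?case by (simp add: distrib_left trig_poly.add)
  qed
next
  case (add f g)
  then show ?case by (simp add: distrib_right trig_poly.add)
qed

lemma trig_poly_cos: "trig_poly (\<lambda>x. complex_of_real (cos (a * (x \<bullet> b))))"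
proof -
  have *: "(\<lambda>x. complex_of_real (cos (a * (x \<bullet> b)))) = (\<lambda>x. 1 / 2 * iexp ((a *\<^sub>R b) \<bullet> x) + 1 / 2 * iexp ((- a *\<^sub>R b) \<bullet> x))"
    by (simp add: cos_of_real[symmetric] cos_exp_eq inner_commute fun_eq_iff field_simps)
  show ?thesis unfolding * by (intro trig_poly.intros)
qed

lemma trig_poly_sin: "trig_poly (\<lambda>x. complex_of_real (sin (a * (x \<bullet> b))))"
proof -
  have *: "(\<lambda>x. complex_of_real (sin (a * (x \<bullet> b)))) = (\<lambda>x. (- \<i> / 2) * iexp ((a *\<^sub>R b) \<bullet> x) + (\<i> / 2) * iexp ((- a *\<^sub>R b) \<bullet> x))"
    by (simp add: sin_of_real[symmetric] sin_exp_eq inner_commute fun_eq_iff field_simps)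
  show ?thesis unfolding * by (intro trig_poly.intros)
qed

lemma trig_poly_bounded_continuous:
  assumes "trig_poly f"
  shows "continuous_on UNIV f \<and> (\<exists>B. \<forall>x. cmod (f x) \<le> B)"
  using assms
proof induction
  case (monomial c u)
  have "\<forall>x. cmod (c * iexp (u \<bullet> x)) \<le> cmod c"
    by (simp add: norm_mult)
  then show ?case by (auto intro!: continuous_intros)
next
  case (add f g)
  then obtain B C where "\<forall>x. cmod (f x) \<le> B" "\<forall>x. cmod (g x) \<le> C" by blast
  then have "\<forall>x. cmod (f x + g x) \<le> B + C" by (meson norm_triangle_mono)
  with add show ?case by (auto intro!: continuous_intros)
qed

lemma trig_poly_integrable:
  assumes "trig_poly f" "prob_space M" and [measurable]: "(\<lambda>x. x) \<in> M \<rightarrow>\<^sub>M borel"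
  shows "integrable M f"
proof -
  interpret prob_space M by fact
  from trig_poly_bounded_continuous[OF assms(1)] obtain B where
    c: "continuous_on UNIV f" and B: "\<And>x. cmod (f x) \<le> B" by blast
  have [measurable]: "f \<in> borel_measurable borel" 
    using c by (rule borel_measurable_continuous_onI)
  show ?thesis by (rule integrable_const_bound[of _ B]) (auto simp: B)
qed

lemma trig_poly_integral_tendsto:
  fixes M :: "nat \<Rightarrow> ('a::euclidean_space) measure"
  assumes M: "\<And>n. prob_space (M n)" "\<And>n. (\<lambda>x. x) \<in> M n \<rightarrow>\<^sub>M borel"
    and N: "prob_space N" "(\<lambda>x. x) \<in> N \<rightarrow>\<^sub>M borel"
    and char: "\<And>u. (\<lambda>n. \<integral>x. iexp (u \<bullet> x) \<partial>M n) \<longlonglongrightarrow> (\<integral>x. iexp (u \<bullet> x) \<partial>N)"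
    and "trig_poly f"
  shows "(\<lambda>n. integral\<^sup>L (M n) f) \<longlonglongrightarrow> integral\<^sup>L N f"
  using \<open>trig_poly f\<close>
proof induction
  case (monomial c u)
  show ?case by (simp add: tendsto_mult_left[OF char])
next
  case (add f g)
  then show ?case
    using M N by (simp add: trig_poly_integrable tendsto_add)
qed

text \<open>The torus is embedded in pairs of vectors, cosines first and sines second, so that its
  points lie in a Euclidean space and polynomials in their coordinates are trigonometric polynomials
  in \<open>x\<close>.\<close>

definition torus_map :: "real \<Rightarrow> 'a::euclidean_space \<Rightarrow> 'a \<times> 'a" where
  "torus_map a x = ((\<Sum>b\<in>Basis. cos (a * (x \<bullet> b)) *\<^sub>R b), (\<Sum>b\<in>Basis. sin (a * (x \<bullet> b)) *\<^sub>R b))"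

text \<open>Only the linear case has content: a linear functional of the torus point is a
  combination of cosines and sines of single coordinates. Closure under sums and products does the
  rest.\<close>

lemma trig_poly_polynomial_torus_map:
  fixes P :: "'a::euclidean_space \<times> 'a \<Rightarrow> real"
  assumes "real_polynomial_function P"
  shows "trig_poly (\<lambda>x. complex_of_real (P (torus_map a x)))"
  using assms
proof induction
  case (linear f)
  interpret bounded_linear f by fact
  have *: "torus_map a x = (\<Sum>b\<in>Basis. cos (a * (x \<bullet> b)) *\<^sub>R (b, 0) + sin (a * (x \<bullet> b)) *\<^sub>R (0, b))" for x :: 'a
    by (simp add: torus_map_def prod_eq_iff fst_sum snd_sum)
  have "complex_of_real (f (torus_map a x)) =
      (\<Sum>b\<in>Basis. complex_of_real (cos (a * (x \<bullet> b))) * complex_of_real (f (b, 0))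
        + complex_of_real (sin (a * (x \<bullet> b))) * complex_of_real (f (0, b)))" for x :: 'a
    unfolding * by (simp only: sum add scaleR of_real_sum of_real_add of_real_mult real_scaleR_def)
  then show ?case
    by (auto intro!: trig_poly_sum trig_poly.add trig_poly_mult trig_poly_cos trig_poly_sin trig_poly_const)
next
  case (const c)
  show ?case by (rule trig_poly_const)
next
  case (add f g)
  then show ?case by (simp add: trig_poly.add)
next
  case (mult f g)
  then show ?case by (simp add: trig_poly_mult)
qed

lemma continuous_on_torus_map [continuous_intros]: "continuous_on A (torus_map a)"
  unfolding torus_map_def by (intro continuous_intros)

lemma torus_map_component_eq:
  assumes "torus_map a x = torus_map a y" "b \<in> Basis"
  shows "cos (a * (x \<bullet> b)) = cos (a * (y \<bullet> b))" "sin (a * (x \<bullet> b)) = sin (a * (y \<bullet> b))"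
proof -
  have "fst (torus_map a x) \<bullet> b = fst (torus_map a y) \<bullet> b" "snd (torus_map a x) \<bullet> b = snd (torus_map a y) \<bullet> b"
    using assms by auto
  then show "cos (a * (x \<bullet> b)) = cos (a * (y \<bullet> b))" "sin (a * (x \<bullet> b)) = sin (a * (y \<bullet> b))"
    using assms(2) by (auto simp: torus_map_def)
qed

text \<open>A coordinate in which the points differ does so by a nonzero multiple of 2L, which
  inside the cube forces opposite faces. Both points then lie where a function supported in the ball
  of radius \<open>L\<close> vanishes.\<close>

lemma torus_map_eq_cube:
  fixes x y :: "'a::euclidean_space"
  assumes L: "L > 0" and eq: "torus_map (pi / L) x = torus_map (pi / L) y"
    and x: "\<And>b. b \<in> Basis \<Longrightarrow> \<bar>x \<bullet> b\<bar> \<le> L" and y: "\<And>b. b \<in> Basis \<Longrightarrow> \<bar>y \<bullet> b\<bar> \<le> L"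
    and "x \<noteq> y"
  shows "norm x \<ge> L" "norm y \<ge> L"
proof -
  obtain b where b: "b \<in> Basis" "x \<bullet> b \<noteq> y \<bullet> b"
    using \<open>x \<noteq> y\<close> by (auto simp: euclidean_eq_iff[of x y])
  obtain k :: int where k: "pi / L * (x \<bullet> b) = pi / L * (y \<bullet> b) + 2 * pi * k"
    using torus_map_component_eq[OF eq b(1)] sin_cos_eq_iff by (metis)
  have "x \<bullet> b = (pi / L * (x \<bullet> b)) * (L / pi)" using L by simp
  also have "\<dots> = y \<bullet> b + 2 * L * k" unfolding k using L by (simp add: field_simps)
  finally have k': "x \<bullet> b = y \<bullet> b + 2 * L * k" .
  then have "k \<noteq> 0" using b by auto
  then have "\<bar>real_of_int k\<bar> \<ge> 1" by linarith
  then have "2 * L \<le> \<bar>2 * L * k\<bar>" using L by (simp add: abs_mult)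
  then have "\<bar>x \<bullet> b\<bar> \<ge> L" "\<bar>y \<bullet> b\<bar> \<ge> L" using k' x[OF b(1)] y[OF b(1)] by linarith+
  then show "norm x \<ge> L" "norm y \<ge> L" using Basis_le_norm[OF b(1)] order_trans by blast+
qed

text \<open>Subtracting the nearest multiple of 2L from each coordinate leaves the image unchanged.
  Hence a bound on the cube for a function of the torus point is a bound everywhere.\<close>

lemma torus_map_cube_surj:
  fixes x :: "'a::euclidean_space"
  assumes L: "L > 0"
  obtains y where "\<And>b. b \<in> Basis \<Longrightarrow> \<bar>y \<bullet> b\<bar> \<le> L" "torus_map (pi / L) y = torus_map (pi / L) x"
proof
  define m where "m b = round (x \<bullet> b / (2 * L))" for b
  define y where "y = (\<Sum>b\<in>Basis. (x \<bullet> b - 2 * L * m b) *\<^sub>R b)"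
  have y: "y \<bullet> b = x \<bullet> b - 2 * L * m b" if "b \<in> Basis" for b
    using that by (simp add: y_def)
  show "\<bar>y \<bullet> b\<bar> \<le> L" if "b \<in> Basis" for b
  proof -
    have "\<bar>m b - x \<bullet> b / (2 * L)\<bar> \<le> 1 / 2"
      unfolding m_def by (rule of_int_round_abs_le)
    then have "2 * L * \<bar>m b - x \<bullet> b / (2 * L)\<bar> \<le> 2 * L * (1 / 2)"
      using L by (intro mult_left_mono) auto
    moreover have "2 * L * \<bar>m b - x \<bullet> b / (2 * L)\<bar> = \<bar>2 * L * m b - x \<bullet> b\<bar>"
    proof -
      have "2 * L * \<bar>m b - x \<bullet> b / (2 * L)\<bar> = \<bar>2 * L * (m b - x \<bullet> b / (2 * L))\<bar>"
        using L by (simp add: abs_mult)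
      also have "2 * L * (m b - x \<bullet> b / (2 * L)) = 2 * L * m b - x \<bullet> b"
        using L by (simp add: field_simps)
      finally show ?thesis .
    qed
    ultimately show ?thesis using y[OF that] by simp
  qed
  have "pi / L * (y \<bullet> b) = pi / L * (x \<bullet> b) - 2 * pi * m b" if "b \<in> Basis" for b
    unfolding y[OF that] using L by (simp add: field_simps)
  then show "torus_map (pi / L) y = torus_map (pi / L) x"
    unfolding torus_map_def
    by (auto intro!: sum.cong simp: cos_diff sin_diff)
qed

text \<open>A function supported in the ball of radius \<open>L\<close> extends \<open>2L\<close>-periodically, hence factors through
  a torus, where Stone--Weierstrass applies. Periodicity is what bounds the approximant on the
  whole space and not only on the ball.\<close>

lemma trig_poly_approx:
  fixes f :: "'a::euclidean_space \<Rightarrow> real"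
  assumes f: "continuous_on UNIV f" and supp: "\<And>x. norm x \<ge> L \<Longrightarrow> f x = 0"
    and L: "L > 0" and B: "\<And>x. \<bar>f x\<bar> \<le> B" and e: "e > 0"
  obtains h where "trig_poly (\<lambda>x. complex_of_real (h x))"
    "\<And>x. norm x \<le> L \<Longrightarrow> \<bar>f x - h x\<bar> < e" "\<And>x. \<bar>h x\<bar> \<le> B + e"
proof -
  define E where "E = (torus_map (pi / L) :: 'a \<Rightarrow> _)"
  define K where "K = cbox (- L *\<^sub>R One) (L *\<^sub>R (One::'a))"
  have K: "x \<in> K \<longleftrightarrow> (\<forall>b\<in>Basis. \<bar>x \<bullet> b\<bar> \<le> L)" for x
    by (auto simp: K_def mem_box abs_le_iff)
  \<comment> \<open>\<open>g\<close> is the function induced on the torus, read off at an arbitrary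
    preimage in the cube; \<open>gE\<close> shows that the choice does not matter.\<close>
  define g where "g z = f (SOME x. x \<in> K \<and> E x = z)" for z
  have gE: "g (E x) = f x" if "x \<in> K" for x
  proof -
    define y where "y = (SOME y. y \<in> K \<and> E y = E x)"
    have "y \<in> K \<and> E y = E x" unfolding y_def using that by (rule_tac someI[of _ x]) auto
    then have "f y = f x"
      using torus_map_eq_cube[OF L, of x y] that supp[of x] supp[of y] K unfolding E_def
      by metis
    then show ?thesis by (simp add: g_def y_def)
  qed
  have cK: "compact K" by (simp add: K_def)
  have cE: "continuous_on A E" for A unfolding E_def by (rule continuous_on_torus_map)
  have cEK: "compact (E ` K)" using cE cK by (rule compact_continuous_image)
  have "continuous_on (E ` K) g"
  proof -
    have "closed (g -` C \<inter> E ` K)" if "closed C" for C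
    proof -
      \<comment> \<open>The cube is compact, so \<open>E\<close> maps its closed subsets to closed
        sets; continuity of \<open>g\<close> follows through preimages of closed sets, as for a
        quotient map.\<close>
      have "g -` C \<inter> E ` K = E ` (f -` C \<inter> K)" by (auto simp: gE)
      moreover have "compact (f -` C \<inter> K)"
        using cK continuous_closed_vimage[OF that, of f] f
        by (metis closed_Int_compact continuous_on_eq_continuous_at open_UNIV UNIV_I)
      ultimately show ?thesis
        using compact_continuous_image[OF cE] compact_imp_closed by metis
    qed
    then show ?thesis
      using continuous_on_closed_vimage[OF compact_imp_closed[OF cEK]] by blast
  qed
  then obtain P where P: "real_polynomial_function P" "\<And>z. z \<in> E ` K \<Longrightarrow> \<bar>g z - P z\<bar> < e"
    using Stone_Weierstrass_real_polynomial_function[OF cEK _ e] by blast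
  show thesis
  proof (rule that[of "\<lambda>x. P (E x)"])
    show "trig_poly (\<lambda>x. complex_of_real (P (E x)))"
      unfolding E_def by (rule trig_poly_polynomial_torus_map) fact
    show "\<bar>f x - P (E x)\<bar> < e" if "norm x \<le> L" for x
    proof -
      have "x \<in> K" using K that Basis_le_norm order_trans by blast
      then show ?thesis using P(2)[of "E x"] gE by auto
    qed
    show "\<bar>P (E x)\<bar> \<le> B + e" for x
    proof -
      obtain y where "y \<in> K" "E y = E x"
        using torus_map_cube_surj[OF L, of x] K unfolding E_def by metis
      then have "\<bar>f y - P (E x)\<bar> < e" using P(2)[OF imageI, of y] gE[of y] by simp
      with B[of y] show ?thesis by linarith
    qed
  qed
qed

text \<open>Convergence of characteristic functions passes to trigonometric polynomials by
  linearity. Such a polynomial replaces the test function on a large ball; outside it, tightness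
  makes the error small because the polynomial is bounded on the whole space.\<close>

lemma levy_continuity_tight:
  fixes M :: "nat \<Rightarrow> ('a::euclidean_space) measure"
  assumes M: "\<And>n. prob_space (M n)" "\<And>n. (\<lambda>x. x) \<in> M n \<rightarrow>\<^sub>M borel"
    and N: "prob_space N" "(\<lambda>x. x) \<in> N \<rightarrow>\<^sub>M borel"
    and char: "\<And>u. (\<lambda>n. \<integral>x. iexp (u \<bullet> x) \<partial>M n) \<longlonglongrightarrow> (\<integral>x. iexp (u \<bullet> x) \<partial>N)"
    and tightM: "\<And>e. e > 0 \<Longrightarrow> \<exists>R. \<forall>\<^sub>F n in sequentially. measure (M n) {x \<in> space (M n). norm x > R} \<le> e"
  shows "conv_distr M N"
  unfolding conv_distr_def
proof (intro allI impI, elim conjE)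
  fix f :: "'a \<Rightarrow> real"
  assume f: "continuous_on UNIV f" "bounded (range f)"
  obtain B where B: "B > 0" "\<And>x. \<bar>f x\<bar> \<le> B"
    using f(2) unfolding bounded_pos by auto
  have fm: "f \<in> borel_measurable borel" using f(1) by (rule borel_measurable_continuous_onI)
  show "(\<lambda>n. integral\<^sup>L (M n) f) \<longlonglongrightarrow> integral\<^sup>L N f"
  proof (rule LIMSEQ_I)
    fix r :: real assume "r > 0"
    \<comment> \<open>Exchanging \<open>f\<close> for \<open>h\<close> costs \<open>e\<close> on the
      ball plus at most 2B + 1 on a set of measure at most \<open>e\<close>; the cap at 1 is what
      bounds |f - h| by 2B + 1 there. Two exchanges and the convergence for \<open>h\<close> use
      three quarters of \<open>r\<close>.\<close>
    define e where "e = min 1 (r / (4 * (2 * B + 2)))"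
    have e: "e > 0" "e \<le> 1" "(2 * B + 2) * e \<le> r / 4"
    proof -
      show "e > 0" "e \<le> 1" using \<open>r > 0\<close> B by (auto simp: e_def)
      have "(2 * B + 2) * e \<le> (2 * B + 2) * (r / (4 * (2 * B + 2)))"
        using B by (intro mult_left_mono) (auto simp: e_def)
      also have "\<dots> = r / 4" using B by (simp add: field_split_simps)
      finally show "(2 * B + 2) * e \<le> r / 4" .
    qed
    obtain R1 where R1: "\<forall>\<^sub>F n in sequentially. measure (M n) {x \<in> space (M n). norm x > R1} \<le> e"
      using tightM[OF e(1)] by blast
    \<comment> \<open>Tightness of the single measure \<open>N\<close> is continuity from above
      along the sets norm x > n, whose intersection is empty.\<close>
    obtain R2 :: nat where R2: "measure N {x \<in> space N. norm x > R2} < e"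
    proof -
      interpret N: prob_space N by fact
      have [measurable]: "(\<lambda>x. x) \<in> N \<rightarrow>\<^sub>M borel" by fact
      have "(\<lambda>n. measure N {x \<in> space N. norm x > real n}) \<longlonglongrightarrow> measure N (\<Inter>n. {x \<in> space N. norm x > real n})"
        by (rule N.finite_Lim_measure_decseq) (auto simp: decseq_def)
      moreover have "(\<Inter>n. {x \<in> space N. norm x > real n}) = {}"
        by (auto simp: not_less) (metis not_less real_arch_simple)
      ultimately have "(\<lambda>n. measure N {x \<in> space N. norm x > real n}) \<longlonglongrightarrow> 0" by simp
      then have "\<forall>\<^sub>F n in sequentially. measure N {x \<in> space N. norm x > real n} < e"
        using e(1) by (rule order_tendstoD)
      then show ?thesis using that by (auto simp: eventually_sequentially)
    qed
    define R where "R = max R1 (real R2)"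
    have R0: "R \<ge> 0" by (simp add: R_def)
    \<comment> \<open>Continuous cut-off: equal to \<open>f\<close> on the ball of radius
      \<open>R\<close>, zero from radius \<open>R + 1\<close> on, still bounded by
      \<open>B\<close>.\<close>
    define f0 where "f0 x = f x * max 0 (min 1 (R + 1 - norm x))" for x
    obtain h where h: "trig_poly (\<lambda>x. complex_of_real (h x))"
      "\<And>x. norm x \<le> R + 1 \<Longrightarrow> \<bar>f0 x - h x\<bar> < e" "\<And>x. \<bar>h x\<bar> \<le> B + e"
    proof (rule trig_poly_approx[of f0 "R + 1" B e])
      show "continuous_on UNIV f0" unfolding f0_def by (intro continuous_intros f(1))
      show "\<bar>f0 x\<bar> \<le> B" for x
        using B mult_mono[OF B(2)[of x], of "max 0 (min 1 (R + 1 - norm x))" 1] by (simp add: f0_def abs_mult)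
    qed (use R0 e in \<open>auto simp: f0_def\<close>)
    have fh: "\<bar>f x - h x\<bar> \<le> e + (2 * B + 1) * indicator {x. norm x > R} x" for x
    proof (cases "norm x > R")
      case True
      then show ?thesis using B(2)[of x] h(3)[of x] e by auto
    next
      case False
      then show ?thesis using h(2)[of x] by (auto simp: f0_def)
    qed
    have hm: "h \<in> borel_measurable borel"
    proof -
      have "(\<lambda>x. Re (complex_of_real (h x))) \<in> borel_measurable borel"
        using trig_poly_bounded_continuous[OF h(1)]
        by (intro borel_measurable_continuous_onI continuous_intros) auto
      then show ?thesis by simp
    qed
    have diff: "\<bar>integral\<^sup>L Q f - integral\<^sup>L Q h\<bar> \<le> r / 4"
      if Q: "prob_space Q" "(\<lambda>x. x) \<in> Q \<rightarrow>\<^sub>M borel" and t: "measure Q {x \<in> space Q. norm x > R} \<le> e" for Q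
    proof -
      interpret Q: prob_space Q by fact
      have [measurable]: "(\<lambda>x. x) \<in> Q \<rightarrow>\<^sub>M borel" by fact
      note [measurable] = fm hm
      have ind: "integrable Q (indicat_real {x \<in> space Q. norm x > R})"
        by (intro integrable_real_indicator) (auto simp: Q.emeasure_eq_measure)
      have i: "integrable Q f" "integrable Q h"
        using B(2) h(3)
        by (auto intro: Q.integrable_const_bound[of _ B] Q.integrable_const_bound[of _ "B + e"])
      have "\<bar>integral\<^sup>L Q f - integral\<^sup>L Q h\<bar> = \<bar>\<integral>x. f x - h x \<partial>Q\<bar>" using i by simp
      also have "\<dots> \<le> (\<integral>x. \<bar>f x - h x\<bar> \<partial>Q)" by (rule integral_abs_bound)
      also have "\<dots> \<le> (\<integral>x. e + (2 * B + 1) * indicator {x \<in> space Q. norm x > R} x \<partial>Q)"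
      proof (intro integral_mono)
        show "\<bar>f x - h x\<bar> \<le> e + (2 * B + 1) * indicator {x \<in> space Q. norm x > R} x" if "x \<in> space Q" for x
          using fh[of x] that by (auto simp: indicator_def)
        show "integrable Q (\<lambda>x. e + (2 * B + 1) * indicator {x \<in> space Q. norm x > R} x)"
          using ind by auto
      qed (use i in auto)
      also have "\<dots> = e + (2 * B + 1) * measure Q {x \<in> space Q. norm x > R}"
        using ind by (subst Bochner_Integration.integral_add) (auto simp: Q.prob_space)
      also have "\<dots> \<le> e + (2 * B + 1) * e" using t B by (intro add_left_mono mult_left_mono) auto
      also have "\<dots> \<le> r / 4" using e(3) by (simp add: algebra_simps)
      finally show ?thesis .
    qed
    have nn: "\<bar>integral\<^sup>L N f - integral\<^sup>L N h\<bar> \<le> r / 4"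
    proof -
      interpret Q: prob_space N by fact
      have [measurable]: "(\<lambda>x. x) \<in> N \<rightarrow>\<^sub>M borel" by fact
      have "measure N {x \<in> space N. norm x > R} \<le> measure N {x \<in> space N. norm x > R2}"
        by (rule Q.finite_measure_mono) (auto simp: R_def)
      then show ?thesis using N R2 by (intro diff) auto
    qed
    have "(\<lambda>n. \<integral>x. complex_of_real (h x) \<partial>M n) \<longlonglongrightarrow> (\<integral>x. complex_of_real (h x) \<partial>N)"
      by (rule trig_poly_integral_tendsto) fact+
    then have "(\<lambda>n. integral\<^sup>L (M n) h) \<longlonglongrightarrow> integral\<^sup>L N h"
      by (simp add: tendsto_of_real_iff)
    then have "\<forall>\<^sub>F n in sequentially. dist (integral\<^sup>L (M n) h) (integral\<^sup>L N h) < r / 4"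
      using \<open>r > 0\<close> by (intro tendstoD) auto
    moreover have "\<forall>\<^sub>F n in sequentially. \<bar>integral\<^sup>L (M n) f - integral\<^sup>L (M n) h\<bar> \<le> r / 4"
      using R1
    proof eventually_elim
      case (elim n)
      interpret Q: prob_space "M n" by fact
      have [measurable]: "(\<lambda>x. x) \<in> M n \<rightarrow>\<^sub>M borel" by fact
      have "measure (M n) {x \<in> space (M n). norm x > R} \<le> measure (M n) {x \<in> space (M n). norm x > R1}"
        by (rule Q.finite_measure_mono) (auto simp: R_def)
      then show ?case using M elim by (intro diff) auto
    qed
    ultimately have "\<forall>\<^sub>F n in sequentially. norm (integral\<^sup>L (M n) f - integral\<^sup>L N f) < r"
    proof (eventually_elim)
      case (elim n) then show ?case using nn \<open>r > 0\<close> unfolding dist_real_def real_norm_def by linarith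
    qed
    then show "\<exists>no. \<forall>n\<ge>no. norm (integral\<^sup>L (M n) f - integral\<^sup>L N f) < r"
      by (simp add: eventually_sequentially)
  qed
qed

section \<open>The isotropic Gaussian measure\<close>

lemma integral_lborel_prod:
  fixes f :: "'a::euclidean_space \<Rightarrow> real \<Rightarrow> complex"
  assumes f: "\<And>b. b \<in> Basis \<Longrightarrow> integrable lborel (f b)"
  shows "(\<integral>x. (\<Prod>b\<in>Basis. f b (x \<bullet> b)) \<partial>lborel) = (\<Prod>b\<in>Basis. \<integral>x. f b x \<partial>lborel)"
proof -
  interpret product_sigma_finite "\<lambda>_::'a. lborel :: real measure" ..
  have [measurable]: "\<And>b. b \<in> Basis \<Longrightarrow> f b \<in> borel_measurable borel"
    using f by auto
  have "(\<integral>x. (\<Prod>b\<in>Basis. f b (x \<bullet> b)) \<partial>lborel) = (\<integral>y. (\<Prod>b\<in>Basis. f b (y b)) \<partial>(\<Pi>\<^sub>M b\<in>Basis. lborel))"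
    by (subst lborel_eq, subst integral_distr) (auto intro!: Bochner_Integration.integral_cong prod.cong)
  also have "\<dots> = (\<Prod>b\<in>Basis. \<integral>x. f b x \<partial>lborel)"
    using f by (intro product_integral_prod) auto
  finally show ?thesis .
qed

lemma prod_Basis_vec:
  fixes F :: "real^'n::finite \<Rightarrow> 'b::comm_monoid_mult"
  shows "(\<Prod>b\<in>Basis. F b) = (\<Prod>i\<in>UNIV. F (axis i (1::real)))"
proof -
  have "(Basis :: (real^'n) set) = range (\<lambda>i. axis i 1)" by (auto simp: Basis_vec_def)
  moreover have "inj (\<lambda>i::'n. axis i (1::real))" by (auto simp: inj_def axis_eq_axis)
  ultimately show ?thesis by (metis (no_types, lifting) prod.reindex_cong)
qed

text \<open>The substitution x -> s x reduces this to the characteristic function of the standard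
  normal law.\<close>

lemma integral_normal_density_iexp:
  assumes "s > 0"
  shows "(\<integral>x. complex_of_real (normal_density 0 s x) * iexp (t * x) \<partial>lborel) = complex_of_real (exp (- (s\<^sup>2 * t\<^sup>2) / 2))"
proof -
  have eq: "s * normal_density 0 s (s * x) = std_normal_density x" for x
    using assms by (simp add: normal_density_def real_sqrt_mult field_simps)
  have "(\<integral>x. complex_of_real (normal_density 0 s x) * iexp (t * x) \<partial>lborel)
      = \<bar>s\<bar> *\<^sub>R (\<integral>x. complex_of_real (normal_density 0 s (0 + s * x)) * iexp (t * (0 + s * x)) \<partial>lborel)"
    using assms by (intro lborel_integral_real_affine) auto
  also have "\<dots> = (\<integral>x. \<bar>s\<bar> *\<^sub>R (complex_of_real (normal_density 0 s (0 + s * x)) * iexp (t * (0 + s * x))) \<partial>lborel)"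
    by simp
  also have "\<dots> = (\<integral>x. std_normal_density x *\<^sub>R iexp ((t * s) * x) \<partial>lborel)"
    using assms by (intro Bochner_Integration.integral_cong)
      (auto simp: eq[symmetric] scaleR_conv_of_real mult_ac)
  also have "\<dots> = char std_normal_distribution (t * s)"
    by (simp add: char_def integral_density)
  also have "\<dots> = complex_of_real (exp (- (s\<^sup>2 * t\<^sup>2) / 2))"
    by (simp add: char_std_normal_distribution power_mult_distrib mult.commute)
  finally show ?thesis .
qed

lemma prob_space_gauss_iso:
  assumes "s > 0"
  shows "prob_space (gauss_iso s :: (real^'d::finite) measure)"
proof
  have "emeasure (gauss_iso s :: (real^'d) measure) UNIV = (\<integral>\<^sup>+x. (\<Prod>b\<in>Basis. ennreal (normal_density 0 s ((x::real^'d) \<bullet> b))) \<partial>lborel)"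
    by (simp add: gauss_iso_def emeasure_density prod_Basis_vec inner_axis prod_ennreal)
  also have "\<dots> = (\<Prod>b\<in>(Basis :: (real^'d) set). \<integral>\<^sup>+x. ennreal (normal_density 0 s x) \<partial>lborel)"
    by (rule nn_integral_lborel_prod) auto
  also have "(\<integral>\<^sup>+x. ennreal (normal_density 0 s x) \<partial>lborel) = 1"
    using assms by (simp add: nn_integral_eq_integral)
  finally show "emeasure (gauss_iso s :: (real^'d) measure) (space (gauss_iso s)) = 1"
    by (simp add: gauss_iso_def)
qed

lemma char_gauss_iso:
  fixes u :: "real^'d::finite"
  assumes "s > 0"
  shows "(\<integral>x. iexp (u \<bullet> x) \<partial>gauss_iso s) = complex_of_real (exp (- (s\<^sup>2 * (norm u)\<^sup>2) / 2))"
proof -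
  have "(\<integral>x. iexp (u \<bullet> x) \<partial>gauss_iso s)
      = (\<integral>x. (\<Prod>i\<in>UNIV. normal_density 0 s (x $ i)) *\<^sub>R iexp (u \<bullet> x) \<partial>lborel)"
    unfolding gauss_iso_def by (subst integral_density) (auto intro!: prod_nonneg)
  also have "\<dots> = (\<integral>x. (\<Prod>b\<in>Basis. complex_of_real (normal_density 0 s (x \<bullet> b)) * iexp ((u \<bullet> b) * (x \<bullet> b))) \<partial>lborel)"
  proof (intro Bochner_Integration.integral_cong refl)
    fix x :: "real^'d"
    have "iexp (u \<bullet> x) = (\<Prod>i\<in>UNIV. iexp (u $ i * x $ i))"
      by (simp add: inner_vec_def exp_sum sum_distrib_left)
    then show "(\<Prod>i\<in>UNIV. normal_density 0 s (x $ i)) *\<^sub>R iexp (u \<bullet> x)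
        = (\<Prod>b\<in>Basis. complex_of_real (normal_density 0 s (x \<bullet> b)) * iexp ((u \<bullet> b) * (x \<bullet> b)))"
      by (simp add: prod_Basis_vec inner_axis prod.distrib scaleR_conv_of_real)
  qed
  also have "\<dots> = (\<Prod>b\<in>Basis. \<integral>x. complex_of_real (normal_density 0 s x) * iexp ((u \<bullet> b) * x) \<partial>lborel)"
  proof (rule integral_lborel_prod)
    fix b :: "real^'d"
    have "integrable lborel (\<lambda>x. complex_of_real (normal_density 0 s x))"
      using assms by auto
    then show "integrable lborel (\<lambda>x. complex_of_real (normal_density 0 s x) * iexp ((u \<bullet> b) * x))"
      by (rule Bochner_Integration.integrable_bound) (auto simp: norm_mult)
  qed
  also have "\<dots> = (\<Prod>i\<in>UNIV. complex_of_real (exp (- (s\<^sup>2 * (u $ i)\<^sup>2) / 2)))"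
    unfolding integral_normal_density_iexp[OF assms] by (simp add: prod_Basis_vec inner_axis)
  also have "\<dots> = complex_of_real (exp (\<Sum>i\<in>UNIV. - (s\<^sup>2 * (u $ i)\<^sup>2) / 2))"
    by (simp add: exp_sum)
  also have "(\<Sum>i\<in>UNIV. - (s\<^sup>2 * (u $ i)\<^sup>2) / 2) = - (s\<^sup>2 * (norm u)\<^sup>2) / 2"
    by (simp add: norm_vec_def L2_set_def sum_nonneg sum_distrib_left sum_negf sum_divide_distrib)
  finally show ?thesis .
qed

section \<open>The step law at the critical parameter\<close>

definition unit_steps :: "(real^'d::finite) set" where
  "unit_steps = (basis_vec ` UNIV) \<union> ((\<lambda>i. - basis_vec i) ` UNIV)"

lemma basis_vec_eq_axis: "basis_vec i = axis i 1"
  by (auto simp: basis_vec_def axis_def vec_eq_iff)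

lemma inj_basis_vec: "inj (basis_vec :: 'd::finite \<Rightarrow> real^'d)"
  by (auto simp: inj_def basis_vec_eq_axis axis_eq_axis)

lemma finite_unit_steps [simp]: "finite unit_steps"
  by (simp add: unit_steps_def)

lemma basis_vec_neq_uminus: "basis_vec i \<noteq> - basis_vec j"
proof
  assume "basis_vec i = - basis_vec j"
  then have "basis_vec i $ i = - basis_vec j $ i" by simp
  then show False by (auto simp: basis_vec_def split: if_splits)
qed

lemma sum_unit_steps: "(\<Sum>x\<in>unit_steps. h x) = (\<Sum>i\<in>UNIV. h (basis_vec i) + h (- basis_vec i))"
proof -
  have "(\<Sum>x\<in>unit_steps. h x) = (\<Sum>x\<in>range basis_vec. h x) + (\<Sum>x\<in>range (\<lambda>i. - basis_vec i). h x)"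
    unfolding unit_steps_def using basis_vec_neq_uminus by (intro sum.union_disjoint) auto
  also have "(\<Sum>x\<in>range basis_vec. h x) = (\<Sum>i\<in>UNIV. h (basis_vec i))"
    by (simp add: sum.reindex inj_basis_vec)
  also have "(\<Sum>x\<in>range (\<lambda>i. - basis_vec i). h x) = (\<Sum>i\<in>UNIV. h (- basis_vec i))"
    using inj_basis_vec by (subst sum.reindex) (auto simp: inj_def)
  finally show ?thesis by (simp add: sum.distrib)
qed

lemma card_unit_steps: "card (unit_steps :: (real^'d::finite) set) = 2 * CARD('d)"
  using sum_unit_steps[of "\<lambda>_::real^'d. 1::nat"] by simp

lemma norm_unit_steps: "x \<in> unit_steps \<Longrightarrow> norm x = 1"
  by (auto simp: unit_steps_def basis_vec_eq_axis)

section \<open>Action of the cyclic matrix on the axes\<close>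

lemma bij_betw_coord: "bij_betw coord {0..<CARD('d)} (UNIV :: 'd::finite set)"
  unfolding coord_def
  by (rule someI_ex[of "\<lambda>f. bij_betw f {0..<CARD('d)} (UNIV :: 'd set)"])
    (simp add: ex_bij_betw_nat_finite)

lemma coord_coord_idx: "coord (coord_idx i) = (i :: 'd::finite)"
  unfolding coord_idx_def using bij_betw_coord[where 'd='d] by (intro f_the_inv_into_f_bij_betw) auto

lemma coord_idx_coord: "k < CARD('d) \<Longrightarrow> coord_idx (coord k :: 'd::finite) = k"
  unfolding coord_idx_def using bij_betw_coord[where 'd='d]
  by (intro the_inv_into_f_f) (auto simp: bij_betw_def)

lemma coord_idx_less: "coord_idx (i :: 'd::finite) < CARD('d)"
proof -
  have "coord_idx i \<in> {0..<CARD('d)}"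
    unfolding coord_idx_def using bij_betw_the_inv_into[OF bij_betw_coord[where 'd='d]]
    by (rule bij_betw_apply) simp
  then show ?thesis by simp
qed

text \<open>Subtraction modulo d on natural numbers: adding d first keeps the difference from being
  truncated at 0.\<close>

lemma add_diff_mod_self:
  fixes a d k :: nat
  assumes "a < d" "k \<le> d"
  shows "(a + d - k) mod d = (if k \<le> a then a - k else a + d - k)"
proof (cases "k \<le> a")
  case True
  then have "a + d - k = (a - k) + d" by simp
  then show ?thesis using True assms by (simp only: mod_add_self2) simp
next
  case False then show ?thesis using assms by simp
qed

lemma eq_Suc_mod_iff:
  fixes a b d :: nat
  assumes "a < d" "b < d"
  shows "a = (b + 1) mod d \<longleftrightarrow> b = (a + d - 1) mod d"
proof (cases "b + 1 = d")
  case True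
  then show ?thesis using assms add_diff_mod_self[of a d 1] by auto
next
  case False
  then have "(b + 1) mod d = b + 1" using assms by simp
  then show ?thesis using assms add_diff_mod_self[of a d 1] by auto
qed

text \<open>The one in column i of J stands in row i - 1, so J lowers the index by one; adding
  \<open>CARD('d) - 1\<close> gives this predecessor modulo d.\<close>

lemma cyc_J_mult_basis_vec:
  fixes i :: "'d::finite"
  shows "cyc_J *v basis_vec i = basis_vec (coord ((coord_idx i + CARD('d) - 1) mod CARD('d)))"
proof -
  have "(cyc_J *v basis_vec i) $ j = (if coord_idx i = (coord_idx j + 1) mod CARD('d) then 1 else 0)" for j
  proof -
    have "(cyc_J *v basis_vec i) $ j = (\<Sum>l\<in>UNIV. if l = i then (if coord_idx i = (coord_idx j + 1) mod CARD('d) then 1 else 0) else 0)"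
      unfolding matrix_vector_mult_def cyc_J_def basis_vec_def vec_lambda_beta
      by (intro sum.cong) auto
    then show ?thesis by simp
  qed
  moreover have "coord_idx i = (coord_idx j + 1) mod CARD('d) \<longleftrightarrow> j = coord ((coord_idx i + CARD('d) - 1) mod CARD('d))" for j :: 'd
  proof -
    have "coord_idx i = (coord_idx j + 1) mod CARD('d) \<longleftrightarrow> coord_idx j = (coord_idx i + CARD('d) - 1) mod CARD('d)"
      by (rule eq_Suc_mod_iff) (rule coord_idx_less)+
    also have "\<dots> \<longleftrightarrow> j = coord ((coord_idx i + CARD('d) - 1) mod CARD('d))"
      using coord_coord_idx[of j] coord_idx_coord by (metis mod_less_divisor zero_less_card_finite)
    finally show ?thesis .
  qed
  ultimately show ?thesis by (auto simp: vec_eq_iff basis_vec_def)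
qed

lemma mat_pow_cyc_J_mult_basis_vec:
  fixes i :: "'d::finite"
  assumes "k \<le> CARD('d)"
  shows "mat_pow cyc_J k *v basis_vec i = basis_vec (coord ((coord_idx i + CARD('d) - k) mod CARD('d)))"
  using assms
proof (induction k arbitrary: i)
  case 0
  then show ?case using coord_idx_less[of i] by (simp add: mat_pow_def coord_coord_idx)
next
  case (Suc k)
  let ?d = "CARD('d)"
  let ?j = "(coord_idx i + ?d - 1) mod ?d"
  \<comment> \<open>\<open>mat_pow\<close> multiplies on the right, so the extra factor acts on the
    vector first and the induction hypothesis is needed at another index.\<close>
  have "mat_pow cyc_J (Suc k) *v basis_vec i = mat_pow cyc_J k *v (cyc_J *v basis_vec i)"
    by (simp add: mat_pow_def matrix_vector_mul_assoc)
  also have "\<dots> = basis_vec (coord ((?j + ?d - k) mod ?d))"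
    using Suc by (simp add: cyc_J_mult_basis_vec coord_idx_coord)
  also have "(?j + ?d - k) mod ?d = (coord_idx i + ?d - Suc k) mod ?d"
  proof -
    have "(?j + ?d - k) mod ?d = ((coord_idx i + ?d - 1) mod ?d + (?d - k)) mod ?d"
      using Suc.prems by (intro arg_cong[where f="\<lambda>x. x mod ?d"]) linarith
    also have "\<dots> = (coord_idx i + ?d - Suc k + ?d) mod ?d"
      using Suc.prems by (subst mod_add_left_eq) (intro arg_cong[where f="\<lambda>x. x mod ?d"], linarith)
    finally show ?thesis by simp
  qed
  finally show ?case .
qed

text \<open>The powers of J act simply transitively on the axes: lowering the index by 0, ..., d - 1
  meets every axis once.\<close>

lemma sum_mat_pow_cyc_J_orbit:
  fixes i :: "'d::finite" and g :: "real^'d \<Rightarrow> 'c::comm_monoid_add"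
  shows "(\<Sum>k\<in>{0..<CARD('d)}. g (mat_pow cyc_J k *v basis_vec i)) = (\<Sum>j\<in>UNIV. g (basis_vec j))"
proof -
  let ?d = "CARD('d)"
  let ?f = "\<lambda>k. (coord_idx i + ?d - k) mod ?d"
  have "inj_on ?f {0..<?d}"
    using coord_idx_less[of i] by (auto simp: inj_on_def add_diff_mod_self split: if_splits)
  then have "bij_betw ?f {0..<?d} {0..<?d}"
    unfolding bij_betw_def by (intro conjI endo_inj_surj) auto
  from bij_betw_trans[OF this bij_betw_coord] have "bij_betw (\<lambda>k. coord (?f k) :: 'd) {0..<?d} UNIV"
    by (simp add: o_def)
  from sum.reindex_bij_betw[OF this, of "\<lambda>j. g (basis_vec j)"]
  have "(\<Sum>j\<in>UNIV. g (basis_vec j)) = (\<Sum>k\<in>{0..<?d}. g (basis_vec (coord (?f k))))"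
    by (rule sym)
  also have "\<dots> = (\<Sum>k\<in>{0..<?d}. g (mat_pow cyc_J k *v basis_vec i))"
    by (intro sum.cong refl arg_cong[where f=g], rule mat_pow_cyc_J_mult_basis_vec[symmetric]) auto
  finally show ?thesis by (rule sym)
qed

lemma other_mat_index_nonempty: "{0..<2 * CARD('d::finite) - 1} \<noteq> {}"
proof -
  have "0 < 2 * CARD('d) - 1" using zero_less_card_finite[where 'a='d] by linarith
  then show ?thesis by (metis atLeastLessThan_empty_iff)
qed

lemma expectation_pmf_of_set:
  fixes h :: "'a \<Rightarrow> 'c::{banach, second_countable_topology}"
  assumes "finite A" "A \<noteq> {}"
  shows "measure_pmf.expectation (pmf_of_set A) h = (\<Sum>a\<in>A. h a) /\<^sub>R card A"
proof -
  have "measure_pmf.expectation (pmf_of_set A) h = (\<Sum>a\<in>A. pmf (pmf_of_set A) a *\<^sub>R h a)"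
    by (rule integral_measure_pmf) (use assms in auto)
  also have "\<dots> = (\<Sum>a\<in>A. h a /\<^sub>R card A)"
    using assms by (intro sum.cong) (auto simp: divide_inverse)
  finally show ?thesis by (simp add: scaleR_sum_right)
qed

text \<open>The 2d matrices +-J^k send \<open>x\<close> to each unit step exactly once. Only the
  identity is absent from the list, hence the subtracted \<open>h x\<close>.\<close>

lemma sum_other_mat:
  fixes x :: "real^'d::finite" and h :: "real^'d \<Rightarrow> 'c::ab_group_add"
  assumes "x \<in> unit_steps"
  shows "(\<Sum>j\<in>{0..<2 * CARD('d) - 1}. h (other_mat j *v x)) = (\<Sum>y\<in>unit_steps. h y) - h x"
proof -
  define d where "d = CARD('d)"
  \<comment> \<open>Pairing opposite vectors makes \<open>g\<close> even, so the sign of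
    \<open>x\<close> drops out and the orbit of a basis vector suffices.\<close>
  define g where "g y = h y + h (- y)" for y
  obtain i where i: "x = basis_vec i \<or> x = - basis_vec i"
    using assms by (auto simp: unit_steps_def)
  have neg: "A *v (- y) = - (A *v y)" "(- A) *v y = - (A *v y)" for A :: "real^'d^'d" and y
    by (simp_all add: matrix_vector_mult_def vec_eq_iff sum_negf)
  have d: "d \<ge> 1" using zero_less_card_finite[where 'a='d] unfolding d_def by linarith
  have split: "{0..<2 * d - 1} = insert 0 ({1..<d} \<union> {d..<2 * d - 1})" using d by auto
  have "(\<Sum>j\<in>{0..<2 * d - 1}. h (other_mat j *v x))
      = h (other_mat 0 *v x) + (\<Sum>j\<in>{1..<d}. h (other_mat j *v x)) + (\<Sum>j\<in>{d..<2 * d - 1}. h (other_mat j *v x))"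
    unfolding split using d by (subst sum.insert) (auto simp: sum.union_disjoint add.assoc)
  also have "(\<Sum>j\<in>{d..<2 * d - 1}. h (other_mat j *v x)) = (\<Sum>k\<in>{1..<d}. h (- (mat_pow cyc_J k *v x)))"
    using d by (intro sum.reindex_bij_witness[of _ "\<lambda>k. k + d - 1" "\<lambda>j. j - d + 1"]) (auto simp: other_mat_def d_def[symmetric] neg)
  also have "(\<Sum>j\<in>{1..<d}. h (other_mat j *v x)) = (\<Sum>k\<in>{1..<d}. h (mat_pow cyc_J k *v x))"
    by (intro sum.cong) (auto simp: other_mat_def d_def[symmetric])
  \<comment> \<open>The term of -I is completed to the full pair at k = 0 by adding and subtracting
    \<open>h x\<close>.\<close>
  also have "h (other_mat 0 *v x) = g (mat_pow cyc_J 0 *v x) - h x"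
    by (simp add: other_mat_def neg mat_pow_def g_def)
  also have "g (mat_pow cyc_J 0 *v x) - h x + (\<Sum>k\<in>{1..<d}. h (mat_pow cyc_J k *v x)) + (\<Sum>k\<in>{1..<d}. h (- (mat_pow cyc_J k *v x)))
      = (\<Sum>k\<in>{0..<d}. g (mat_pow cyc_J k *v x)) - h x"
    using d by (simp add: sum.atLeast_Suc_lessThan g_def sum.distrib)
  also have "(\<Sum>k\<in>{0..<d}. g (mat_pow cyc_J k *v x)) = (\<Sum>k\<in>{0..<d}. g (mat_pow cyc_J k *v basis_vec i))"
    using i by (auto simp: neg g_def add.commute)
  also have "\<dots> = (\<Sum>y\<in>unit_steps. h y)"
    unfolding d_def sum_mat_pow_cyc_J_orbit by (simp add: sum_unit_steps g_def)
  finally show ?thesis by (simp add: d_def)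
qed

section \<open>Law of the random matrix and of the next step\<close>

lemma expectation_A_pmf:
  fixes h :: "real^'d^'d::finite \<Rightarrow> 'c::{banach, second_countable_topology}"
  assumes "0 \<le> p" "p \<le> 1"
  shows "measure_pmf.expectation (A_pmf p) h
    = p *\<^sub>R h (mat 1) + ((1 - p) / (2 * real CARD('d) - 1)) *\<^sub>R (\<Sum>j\<in>{0..<2 * CARD('d) - 1}. h (other_mat j))"
proof -
  have d: "CARD('d) \<ge> 1" using zero_less_card_finite[where 'a='d] by linarith
  define q where "q = (map_pmf other_mat (pmf_of_set {0..<2 * CARD('d) - 1}) :: (real^'d^'d) pmf)"
  have "measure_pmf.expectation q h
     = (\<Sum>j\<in>{0..<2 * CARD('d) - 1}. h (other_mat j)) /\<^sub>R (2 * real CARD('d) - 1)"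
    using d unfolding integral_map_pmf q_def
    by (subst expectation_pmf_of_set[OF _ other_mat_index_nonempty]) (auto simp: of_nat_diff)
  moreover have "finite (set_pmf q)"
    unfolding q_def set_map_pmf
    by (subst set_pmf_of_set[OF other_mat_index_nonempty]) auto
  ultimately show ?thesis
    unfolding A_pmf_def q_def[symmetric] using assms
    by (subst pmf_expectation_bind[of UNIV]) (auto simp: UNIV_bool divide_inverse)
qed

text \<open>Conditional mean of \<open>h\<close> at the next step given the past \<open>xs\<close>, at the critical parameter: with
  probability 1/2 a past step is repeated, with probability 1/2 the step is fresh and uniform.\<close>

definition next_step_mean :: "(real^'d::finite) list \<Rightarrow> (real^'d \<Rightarrow> 'c::real_vector) \<Rightarrow> 'c" where
  "next_step_mean xs h = (1 / (2 * length xs)) *\<^sub>R (\<Sum>x\<leftarrow>xs. h x)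
     + (1 / (4 * real CARD('d))) *\<^sub>R (\<Sum>x\<in>unit_steps. h x)"

text \<open>Each of the other matrices has probability (1 - p)/(2d - 1) = 1/(4d). Setting aside the
  same weight at the identity completes a uniform law on all 2d matrices, of total mass 1/2, and
  leaves p - 1/(4d) = 1/2 for exact repetition.\<close>

lemma critical_A_pmf_expectation:
  fixes h :: "real^'d::finite \<Rightarrow> 'c::{banach, second_countable_topology}"
  assumes p: "p = (2 * real CARD('d) + 1) / (4 * real CARD('d))" and "x \<in> unit_steps"
  shows "measure_pmf.expectation (A_pmf p) (\<lambda>A. h (A *v x))
    = (1 / 2) *\<^sub>R h x + (1 / (4 * real CARD('d))) *\<^sub>R (\<Sum>y\<in>unit_steps. h y)"
proof -
  have d: "real CARD('d) \<ge> 1" using zero_less_card_finite[where 'a='d] by linarith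
  have q: "(1 - p) / (2 * real CARD('d) - 1) = 1 / (4 * real CARD('d))"
  proof -
    have "(1 - (2 * D + 1) / (4 * D)) / (2 * D - 1) = 1 / (4 * D)" if "D \<ge> 1" for D :: real
    proof -
      have "2 * D - 1 \<noteq> 0" "D \<noteq> 0" using that by auto
      then show ?thesis by (simp add: divide_simps)
    qed
    from this[OF d] show ?thesis unfolding p by simp
  qed
  have p': "p - 1 / (4 * real CARD('d)) = 1 / 2"
    unfolding p using d by (simp add: field_split_simps)
  have "0 \<le> p" unfolding p by simp
  moreover have "p \<le> 1" unfolding p using d by (subst divide_le_eq_1_pos) linarith+
  ultimately have "measure_pmf.expectation (A_pmf p) (\<lambda>A. h (A *v x))
     = p *\<^sub>R h x + (1 / (4 * real CARD('d))) *\<^sub>R ((\<Sum>y\<in>unit_steps. h y) - h x)"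
    using sum_other_mat[OF assms(2), of h] by (subst expectation_A_pmf) (auto simp: q)
  also have "\<dots> = (p - 1 / (4 * real CARD('d))) *\<^sub>R h x + (1 / (4 * real CARD('d))) *\<^sub>R (\<Sum>y\<in>unit_steps. h y)"
    by (simp add: algebra_simps)
  finally show ?thesis unfolding p' .
qed

section \<open>Support and one-step recursion of the trajectory law\<close>

lemma set_pmf_A_pmf_finite: "finite (set_pmf (A_pmf p :: (real^'d^'d::finite) pmf))"
proof -
  have "set_pmf (pmf_of_set {0..<2 * CARD('d) - 1}) = {0..<2 * CARD('d) - 1}"
    by (intro set_pmf_of_set other_mat_index_nonempty) auto
  then show ?thesis unfolding A_pmf_def by auto
qed

lemma unit_steps_A_pmf:
  fixes x :: "real^'d::finite"
  assumes "x \<in> unit_steps" "A \<in> set_pmf (A_pmf p)"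
  shows "A *v x \<in> unit_steps"
proof -
  have neg: "A *v (- y) = - (A *v y)" "(- A) *v y = - (A *v y)" for A :: "real^'d^'d" and y
    by (simp_all add: matrix_vector_mult_def vec_eq_iff sum_negf)
  have um: "y \<in> unit_steps \<Longrightarrow> - y \<in> unit_steps" for y :: "real^'d" by (auto simp: unit_steps_def)
  have J: "mat_pow cyc_J k *v x \<in> unit_steps" if "k \<le> CARD('d)" for k
    using assms(1) that unfolding unit_steps_def
    by (auto simp: mat_pow_cyc_J_mult_basis_vec neg)
  have "A = mat 1 \<or> (\<exists>j<2 * CARD('d) - 1. A = other_mat j)"
  proof -
    have "set_pmf (pmf_of_set {0..<2 * CARD('d) - 1}) = {0..<2 * CARD('d) - 1}"
      by (intro set_pmf_of_set other_mat_index_nonempty) auto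
    then show ?thesis
      using assms(2) unfolding A_pmf_def by (auto split: if_splits)
  qed
  then show ?thesis using assms(1) J by (auto simp: other_mat_def neg um)
qed

text \<open>Finiteness of the support settles all integrability questions, and pointwise bounds need
  only be checked on lists of \<open>n\<close> unit steps.\<close>

lemma merw_steps_support:
  "set_pmf (merw_steps p n :: (real^'d::finite) list pmf) \<subseteq> {xs. set xs \<subseteq> unit_steps \<and> length xs = n}"
proof (induction p n rule: merw_steps.induct)
  case (2 p)
  have "set_pmf (pmf_of_set (unit_steps :: (real^'d) set)) = unit_steps"
    by (rule set_pmf_of_set) (auto simp: unit_steps_def)
  then have "set_pmf (merw_steps p (Suc 0)) = (\<lambda>x. [x]) ` (unit_steps :: (real^'d) set)"
    unfolding merw_steps.simps unit_steps_def[symmetric] set_map_pmf by (rule arg_cong)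
  then show ?case by (simp add: image_subset_iff)
next
  case (3 p n)
  show ?case
  proof
    fix ys :: "(real^'d) list" assume "ys \<in> set_pmf (merw_steps p (Suc (Suc n)))"
    then obtain xs b A where xs: "xs \<in> set_pmf (merw_steps p (Suc n))"
      and b: "b \<in> set_pmf (pmf_of_set {0..<Suc n})" and A: "A \<in> set_pmf (A_pmf p)"
      and ys: "ys = xs @ [A *v (xs ! b)]"
      unfolding merw_steps.simps set_bind_pmf set_return_pmf by blast
    have xs': "set xs \<subseteq> unit_steps" "length xs = Suc n" using 3 xs by blast+
    have "set_pmf (pmf_of_set {0..<Suc n}) = {0..<Suc n}" by (rule set_pmf_of_set) auto
    then have "b < length xs" using b xs'(2) by simp
    then have "xs ! b \<in> unit_steps" using xs'(1) nth_mem by blast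
    then have "A *v (xs ! b) \<in> unit_steps" using A by (rule unit_steps_A_pmf)
    then show "ys \<in> {xs. set xs \<subseteq> unit_steps \<and> length xs = Suc (Suc n)}"
      using xs' ys by simp
  qed
qed auto

lemma merw_steps_finite: "finite (set_pmf (merw_steps p n))"
  using merw_steps_support by (rule finite_subset) (auto intro: finite_lists_length_eq)

lemma expectation_merw_steps_1:
  fixes F :: "(real^'d::finite) list \<Rightarrow> 'c::{banach, second_countable_topology}"
  shows "measure_pmf.expectation (merw_steps p (Suc 0)) F = (\<Sum>x\<in>unit_steps. F [x]) /\<^sub>R (2 * CARD('d))"
proof -
  have "(unit_steps :: (real^'d) set) \<noteq> {}" by (auto simp: unit_steps_def)
  then show ?thesis
    by (simp add: unit_steps_def[symmetric] expectation_pmf_of_set card_unit_steps)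
qed

text \<open>Tower property: averaging over \<open>b\<close> and then over \<open>A\<close> turns the
  last step into \<open>next_step_mean\<close>. Together with the law of the first step and the
  support, this is all that the later estimates use of the trajectory law.\<close>

lemma expectation_merw_steps_Suc:
  fixes F :: "(real^'d::finite) list \<Rightarrow> 'c::{banach, second_countable_topology}"
  assumes p: "p = (2 * real CARD('d) + 1) / (4 * real CARD('d))"
    and n: "n \<ge> 1"
  shows "measure_pmf.expectation (merw_steps p (Suc n)) F
    = measure_pmf.expectation (merw_steps p n) (\<lambda>xs. next_step_mean xs (\<lambda>x. F (xs @ [x])))"
proof -
  obtain m where m: "n = Suc m" using n by (cases n) auto
  have step: "measure_pmf.expectation (pmf_of_set {0..<Suc m} \<bind> (\<lambda>b. A_pmf p \<bind> (\<lambda>A. return_pmf (xs @ [A *v (xs ! b)])))) F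
     = next_step_mean xs (\<lambda>x. F (xs @ [x]))" if "xs \<in> set_pmf (merw_steps p n)" for xs
  proof -
    have xs: "set xs \<subseteq> unit_steps" "length xs = n" using merw_steps_support that by blast+
    let ?h = "\<lambda>x. F (xs @ [x])"
    have "measure_pmf.expectation (pmf_of_set {0..<Suc m} \<bind> (\<lambda>b. A_pmf p \<bind> (\<lambda>A. return_pmf (xs @ [A *v (xs ! b)])))) F
       = (\<Sum>b\<in>{0..<Suc m}. measure_pmf.expectation (A_pmf p \<bind> (\<lambda>A. return_pmf (xs @ [A *v (xs ! b)]))) F /\<^sub>R real n)"
      unfolding m by (subst pmf_expectation_bind_pmf_of_set) (simp_all add: set_pmf_A_pmf_finite)
    also have "\<dots> = (\<Sum>b\<in>{0..<Suc m}. ((1 / 2) *\<^sub>R ?h (xs ! b) + (1 / (4 * real CARD('d))) *\<^sub>R (\<Sum>y\<in>unit_steps. ?h y)) /\<^sub>R real n)"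
    proof (intro sum.cong refl arg_cong[where f="\<lambda>x. x /\<^sub>R real n"])
      fix b assume "b \<in> {0..<Suc m}"
      then have "xs ! b \<in> unit_steps" using xs m nth_mem[of b xs] by auto
      then show "measure_pmf.expectation (A_pmf p \<bind> (\<lambda>A. return_pmf (xs @ [A *v (xs ! b)]))) F
        = (1 / 2) *\<^sub>R ?h (xs ! b) + (1 / (4 * real CARD('d))) *\<^sub>R (\<Sum>y\<in>unit_steps. ?h y)"
        unfolding map_pmf_def[symmetric] integral_map_pmf
        by (rule critical_A_pmf_expectation[OF p])
    qed
    also have "\<dots> = (1 / (2 * n)) *\<^sub>R (\<Sum>b\<in>{0..<n}. ?h (xs ! b)) + (1 / (4 * real CARD('d))) *\<^sub>R (\<Sum>y\<in>unit_steps. ?h y)"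
    proof -
      have "(\<Sum>b\<in>{0..<n}. ((1 / 2) *\<^sub>R ?h (xs ! b) + c) /\<^sub>R real n) = (1 / (2 * n)) *\<^sub>R (\<Sum>b\<in>{0..<n}. ?h (xs ! b)) + c" for c
      proof -
        have "(\<Sum>b\<in>{0..<n}. ((1 / 2) *\<^sub>R ?h (xs ! b) + c) /\<^sub>R real n)
            = (\<Sum>b\<in>{0..<n}. (1 / (2 * n)) *\<^sub>R ?h (xs ! b)) + (\<Sum>b\<in>{0..<n}. c /\<^sub>R real n)"
          unfolding sum.distrib[symmetric] by (intro sum.cong) (simp_all add: scaleR_add_right field_simps)
        also have "(\<Sum>b\<in>{0..<n}. c /\<^sub>R real n) = c"
          using n by (simp add: sum_constant_scaleR)
        finally show ?thesis by (simp only: scaleR_sum_right)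
      qed
      then show ?thesis unfolding m[symmetric] .
    qed
    also have "(\<Sum>b\<in>{0..<n}. ?h (xs ! b)) = (\<Sum>x\<leftarrow>xs. ?h x)"
      by (simp add: sum_list_sum_nth xs)
    finally show ?thesis by (simp add: next_step_mean_def xs)
  qed
  have Suc_steps: "merw_steps p (Suc n) = merw_steps p n \<bind>
      (\<lambda>xs. pmf_of_set {0..<Suc m} \<bind> (\<lambda>b. A_pmf p \<bind> (\<lambda>A. return_pmf (xs @ [A *v (xs ! b)]))))"
    by (simp only: m merw_steps.simps)
  have "measure_pmf.expectation (merw_steps p (Suc n)) F
     = (\<Sum>xs\<in>set_pmf (merw_steps p n). pmf (merw_steps p n) xs *\<^sub>R next_step_mean xs (\<lambda>x. F (xs @ [x])))"
    unfolding Suc_steps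
  proof (subst pmf_expectation_bind[OF merw_steps_finite])
    have "set_pmf (pmf_of_set {0..<Suc m}) = {0..<Suc m}" by (rule set_pmf_of_set) auto
    then show "finite (set_pmf (pmf_of_set {0..<Suc m} \<bind> (\<lambda>b. A_pmf p \<bind> (\<lambda>A. return_pmf (xs @ [A *v (xs ! b)])))))"
      for xs :: "(real^'d) list"
      by (simp add: set_pmf_A_pmf_finite)
  qed (auto intro!: sum.cong arg_cong[where f="\<lambda>x. _ *\<^sub>R x"] step)
  also have "\<dots> = measure_pmf.expectation (merw_steps p n) (\<lambda>xs. next_step_mean xs (\<lambda>x. F (xs @ [x])))"
    by (rule integral_measure_pmf[symmetric]) (auto simp: merw_steps_finite)
  finally show ?thesis .
qed

section \<open>Second moments\<close>

lemma next_step_mean_linear: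
  assumes "linear f"
  shows "next_step_mean xs (\<lambda>x. f (h x)) = f (next_step_mean xs h)"
proof -
  have "(\<Sum>x\<leftarrow>xs. f (h x)) = f (\<Sum>x\<leftarrow>xs. h x)"
    by (induction xs) (auto simp: linear_0[OF assms] linear_add[OF assms])
  then show ?thesis
    unfolding next_step_mean_def
    by (simp add: linear_add[OF assms] linear_scale[OF assms] linear_sum[OF assms])
qed

lemma next_step_mean_add:
  "next_step_mean xs (\<lambda>x. f x + g x) = next_step_mean xs f + next_step_mean xs g"
  unfolding next_step_mean_def by (simp add: sum_list_addf sum.distrib scaleR_add_right)

lemma next_step_mean_cmult:
  fixes c :: "'a::real_normed_field"
  shows "next_step_mean xs (\<lambda>x. c * h x) = c * next_step_mean xs h"
  by (rule next_step_mean_linear) (auto intro!: linearI simp: algebra_simps)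

lemma next_step_mean_of_real:
  "next_step_mean xs (\<lambda>x. complex_of_real (h x)) = complex_of_real (next_step_mean xs h)"
  by (rule next_step_mean_linear) (auto intro!: linearI simp: scaleR_conv_of_real)

lemma next_step_mean_const:
  assumes "xs \<noteq> []"
  shows "next_step_mean (xs :: (real^'d::finite) list) (\<lambda>_. c) = c"
proof -
  have "(\<Sum>x\<leftarrow>xs. c) = real (length xs) *\<^sub>R c"
    by (induction xs) (auto simp: scaleR_add_left)
  moreover have "(\<Sum>x\<in>(unit_steps :: (real^'d) set). c) = (2 * real CARD('d)) *\<^sub>R c"
    by (simp add: sum_constant_scaleR card_unit_steps)
  ultimately have "next_step_mean xs (\<lambda>_. c) = (1 / 2) *\<^sub>R c + (1 / 2) *\<^sub>R c"
    using assms unfolding next_step_mean_def by simp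
  then show ?thesis by (simp flip: scaleR_add_left)
qed

lemma next_step_mean_mono:
  fixes f g :: "real^'d::finite \<Rightarrow> real"
  assumes "set xs \<subseteq> unit_steps" "\<And>x. x \<in> unit_steps \<Longrightarrow> f x \<le> g x"
  shows "next_step_mean xs f \<le> next_step_mean xs g"
proof -
  have "(\<Sum>x\<leftarrow>xs. f x) \<le> (\<Sum>x\<leftarrow>xs. g x)"
    using assms by (intro sum_list_mono) auto
  moreover have "(\<Sum>x\<in>unit_steps. f x) \<le> (\<Sum>x\<in>unit_steps. g x)"
    using assms by (intro sum_mono) auto
  ultimately show ?thesis
    unfolding next_step_mean_def real_scaleR_def by (intro add_mono mult_left_mono) auto
qed

lemma norm_next_step_mean_le:
  fixes h :: "real^'d::finite \<Rightarrow> 'c::real_normed_vector"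
  assumes "xs \<noteq> []" "set xs \<subseteq> unit_steps" "\<And>x. x \<in> unit_steps \<Longrightarrow> norm (h x) \<le> B"
  shows "norm (next_step_mean xs h) \<le> B"
proof -
  have "norm (next_step_mean xs h) \<le> norm ((1 / (2 * length xs)) *\<^sub>R (\<Sum>x\<leftarrow>xs. h x))
     + norm ((1 / (4 * real CARD('d))) *\<^sub>R (\<Sum>x\<in>unit_steps. h x))"
    unfolding next_step_mean_def by (rule norm_triangle_ineq)
  also have "\<dots> \<le> (1 / (2 * length xs)) *\<^sub>R (\<Sum>x\<leftarrow>xs. norm (h x)) + (1 / (4 * real CARD('d))) *\<^sub>R (\<Sum>x\<in>unit_steps. norm (h x))"
  proof -
    have "norm (\<Sum>x\<leftarrow>xs. h x) \<le> (\<Sum>x\<leftarrow>xs. norm (h x))"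
      by (induction xs) (auto intro: norm_triangle_le)
    then show ?thesis
      unfolding norm_scaleR real_scaleR_def
      by (intro add_mono mult_mono norm_sum) auto
  qed
  also have "\<dots> = next_step_mean xs (\<lambda>x. norm (h x))" by (simp add: next_step_mean_def)
  also have "\<dots> \<le> next_step_mean xs (\<lambda>_. B)"
    using assms by (intro next_step_mean_mono)
  finally show ?thesis using next_step_mean_const[OF assms(1), of B] by simp
qed

lemma expectation_merw_steps_mono:
  fixes f g :: "(real^'d::finite) list \<Rightarrow> real"
  assumes "\<And>xs. set xs \<subseteq> unit_steps \<Longrightarrow> length xs = n \<Longrightarrow> f xs \<le> g xs"
  shows "measure_pmf.expectation (merw_steps p n) f \<le> measure_pmf.expectation (merw_steps p n) g"
proof (rule integral_mono_AE)
  show "AE xs in measure_pmf (merw_steps p n). f xs \<le> g xs"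
    unfolding AE_measure_pmf_iff using assms merw_steps_support[of p n] by blast
qed (auto intro: integrable_measure_pmf_finite merw_steps_finite)

lemma integrable_merw_steps:
  fixes f :: "(real^'d::finite) list \<Rightarrow> 'c::{banach, second_countable_topology}"
  shows "integrable (measure_pmf (merw_steps p n)) f"
  by (rule integrable_measure_pmf_finite) (rule merw_steps_finite)

text \<open>Both bounds are ln t \<le> t - 1, at t = n/(n+1) and t = (n+1)/n. The lower one closes
  the second moment recursion; together they allow 1/n to be replaced by a telescoping
  increment.\<close>

lemma ln_Suc_diff_bounds:
  assumes "n \<ge> 1"
  shows "1 / (real n + 1) \<le> ln (real n + 1) - ln (real n)" "ln (real n + 1) - ln (real n) \<le> 1 / real n"
proof -
  have "ln (real n / (real n + 1)) \<le> real n / (real n + 1) - 1"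
    using assms by (intro ln_le_minus_one) auto
  then show "1 / (real n + 1) \<le> ln (real n + 1) - ln (real n)"
    using assms by (simp add: ln_div field_simps)
  have "ln ((real n + 1) / real n) \<le> (real n + 1) / real n - 1"
    using assms by (intro ln_le_minus_one) auto
  then show "ln (real n + 1) - ln (real n) \<le> 1 / real n"
    using assms by (simp add: ln_div field_simps)
qed

text \<open>\<open>G\<^sub>n = \<Sum> g(X\<^sub>k)\<close> satisfies
  \<open>E G\<^sub>n\<^sub>+\<^sub>1\<^sup>2 \<le> (1 + 1/n) E G\<^sub>n\<^sup>2 + c\<^sup>2\<close>, whose solution grows like \<open>n log n\<close>.\<close>

lemma second_moment_centered_sum:
  fixes g :: "real^'d::finite \<Rightarrow> real"
  assumes p: "p = (2 * real CARD('d) + 1) / (4 * real CARD('d))"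
    and c: "\<And>x. x \<in> unit_steps \<Longrightarrow> \<bar>g x\<bar> \<le> c" and g: "(\<Sum>x\<in>unit_steps. g x) = 0"
    and n: "n \<ge> 1"
  shows "measure_pmf.expectation (merw_steps p n) (\<lambda>xs. (\<Sum>x\<leftarrow>xs. g x)\<^sup>2) \<le> c\<^sup>2 * (real n * (1 + ln (real n)))"
  using n
proof (induction n rule: dec_induct)
  case base
  have g2: "(g x)\<^sup>2 \<le> c\<^sup>2" if "x \<in> unit_steps" for x
    using power_mono[OF c[OF that], of 2] by simp
  have "measure_pmf.expectation (merw_steps p (Suc 0)) (\<lambda>xs. (\<Sum>x\<leftarrow>xs. g x)\<^sup>2)
     = (\<Sum>x\<in>unit_steps. (g x)\<^sup>2) / (2 * real CARD('d))"
    unfolding expectation_merw_steps_1 by (simp add: field_simps)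
  also have "\<dots> \<le> (\<Sum>x\<in>(unit_steps :: (real^'d) set). c\<^sup>2) / (2 * real CARD('d))"
    by (intro divide_right_mono sum_mono g2) auto
  also have "\<dots> = c\<^sup>2" by (simp add: card_unit_steps)
  finally show ?case by simp
next
  case (step n)
  have n: "n \<ge> 1" using step by simp
  have g2: "(g x)\<^sup>2 \<le> c\<^sup>2" if "x \<in> unit_steps" for x
    using power_mono[OF c[OF that], of 2] by simp
  have nsm: "next_step_mean xs (\<lambda>x. (\<Sum>x\<leftarrow>xs @ [x]. g x)\<^sup>2) \<le> (1 + 1 / real n) * (\<Sum>x\<leftarrow>xs. g x)\<^sup>2 + c\<^sup>2"
    if xs: "set xs \<subseteq> unit_steps" "length xs = n" for xs
  proof -
    define G where "G = (\<Sum>x\<leftarrow>xs. g x)"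
    have ne: "xs \<noteq> []" using xs n by auto
    \<comment> \<open>The fresh half averages to zero because \<open>g\<close> is centred; the
      repeated half gives half of the empirical mean. In the square, the cross term then produces
      the factor 1 + 1/n.\<close>
    have mean: "next_step_mean xs g = G / (2 * real n)"
      by (simp add: next_step_mean_def g G_def xs)
    have "next_step_mean xs (\<lambda>x. (\<Sum>x\<leftarrow>xs @ [x]. g x)\<^sup>2) = next_step_mean xs (\<lambda>x. (G\<^sup>2 + 2 * G * g x) + (g x)\<^sup>2)"
      by (simp add: G_def power2_sum algebra_simps)
    also have "\<dots> = G\<^sup>2 + 2 * G * (G / (2 * real n)) + next_step_mean xs (\<lambda>x. (g x)\<^sup>2)"
      unfolding next_step_mean_add next_step_mean_cmult mean next_step_mean_const[OF ne] ..
    also have "next_step_mean xs (\<lambda>x. (g x)\<^sup>2) \<le> c\<^sup>2"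
      using next_step_mean_mono[OF xs(1), of "\<lambda>x. (g x)\<^sup>2" "\<lambda>_. c\<^sup>2"] g2 next_step_mean_const[OF ne, of "c\<^sup>2"] by simp
    also have "G\<^sup>2 + 2 * G * (G / (2 * real n)) = (1 + 1 / real n) * G\<^sup>2"
      by (simp add: power2_eq_square algebra_simps)
    finally show ?thesis by (simp add: G_def)
  qed
  have "measure_pmf.expectation (merw_steps p (Suc n)) (\<lambda>xs. (\<Sum>x\<leftarrow>xs. g x)\<^sup>2)
     = measure_pmf.expectation (merw_steps p n) (\<lambda>xs. next_step_mean xs (\<lambda>x. (\<Sum>x\<leftarrow>xs @ [x]. g x)\<^sup>2))"
    by (rule expectation_merw_steps_Suc[OF p n])
  also have "\<dots> \<le> measure_pmf.expectation (merw_steps p n) (\<lambda>xs. (1 + 1 / real n) * (\<Sum>x\<leftarrow>xs. g x)\<^sup>2 + c\<^sup>2)"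
    by (intro expectation_merw_steps_mono nsm)
  also have "\<dots> = (1 + 1 / real n) * measure_pmf.expectation (merw_steps p n) (\<lambda>xs. (\<Sum>x\<leftarrow>xs. g x)\<^sup>2) + c\<^sup>2"
    by (subst Bochner_Integration.integral_add) (auto simp: integrable_merw_steps)
  also have "\<dots> \<le> (1 + 1 / real n) * (c\<^sup>2 * (real n * (1 + ln (real n)))) + c\<^sup>2"
    using step.IH by (intro add_right_mono mult_left_mono) auto
  also have "\<dots> = c\<^sup>2 * ((real n + 1) * (1 + ln (real n)) + 1)"
    using n by (simp add: field_simps)
  also have "\<dots> \<le> c\<^sup>2 * ((real n + 1) * (1 + ln (real n + 1)))"
  proof (rule mult_left_mono)
    \<comment> \<open>The additive 1 of the recursion is absorbed by the growth of the
      logarithm.\<close>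
    have "1 \<le> (real n + 1) * (ln (real n + 1) - ln (real n))"
      using ln_Suc_diff_bounds(1)[OF n] by (simp add: field_simps)
    then show "(real n + 1) * (1 + ln (real n)) + 1 \<le> (real n + 1) * (1 + ln (real n + 1))"
      by (simp add: algebra_simps)
  qed simp
  finally show ?case by (simp add: add.commute)
qed

section \<open>Linear and quadratic functionals of the steps\<close>

lemma sum_unit_steps_inner: "(\<Sum>x\<in>unit_steps. v \<bullet> x) = 0"
  by (simp add: sum_unit_steps)

lemma sum_unit_steps_inner_sq: "(\<Sum>x\<in>unit_steps. (v \<bullet> x)\<^sup>2) = 2 * (norm v)\<^sup>2"
proof -
  have "(\<Sum>i\<in>UNIV. (v $ i)\<^sup>2) = (norm v)\<^sup>2"
    by (simp add: norm_vec_def L2_set_def sum_nonneg)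
  then show ?thesis
    by (simp add: sum_unit_steps basis_vec_eq_axis inner_axis flip: sum_distrib_left)
qed

lemma abs_inner_unit_step: "x \<in> unit_steps \<Longrightarrow> \<bar>v \<bullet> x\<bar> \<le> norm v"
  using Cauchy_Schwarz_ineq2[of v x] norm_unit_steps[of x] by simp

lemma inner_sum_list: "v \<bullet> sum_list xs = (\<Sum>x\<leftarrow>xs. v \<bullet> x)"
  by (induction xs) (auto simp: inner_add_right)

lemma second_moment_position:
  fixes v :: "real^'d::finite"
  assumes p: "p = (2 * real CARD('d) + 1) / (4 * real CARD('d))" and n: "n \<ge> 1"
  shows "measure_pmf.expectation (merw_steps p n) (\<lambda>xs. (v \<bullet> sum_list xs)\<^sup>2) \<le> (norm v)\<^sup>2 * (real n * (1 + ln (real n)))"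
  unfolding inner_sum_list
  by (rule second_moment_centered_sum[OF p _ sum_unit_steps_inner n]) (rule abs_inner_unit_step)

text \<open>Measures how far the empirical distribution of the axes used so far is from uniform.\<close>

definition axis_defect :: "real^'d::finite \<Rightarrow> (real^'d) list \<Rightarrow> real" where
  "axis_defect v xs = (\<Sum>x\<leftarrow>xs. (v \<bullet> x)\<^sup>2 - (norm v)\<^sup>2 / CARD('d))"

text \<open>The summand is centred because the values (v.x)^2 add up to 2|v|^2 over the 2d unit
  steps. The bound |v|^2 serves as \<open>c\<close>, since (v.x)^2 and its average both lie between
  0 and |v|^2.\<close>

lemma second_moment_axis_defect:
  fixes v :: "real^'d::finite"
  assumes p: "p = (2 * real CARD('d) + 1) / (4 * real CARD('d))" and n: "n \<ge> 1"
  shows "measure_pmf.expectation (merw_steps p n) (\<lambda>xs. (axis_defect v xs)\<^sup>2)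
    \<le> ((norm v)\<^sup>2)\<^sup>2 * (real n * (1 + ln (real n)))"
  unfolding axis_defect_def
proof (rule second_moment_centered_sum[OF p _ _ n])
  show "(\<Sum>x\<in>unit_steps. (v \<bullet> x)\<^sup>2 - (norm v)\<^sup>2 / CARD('d)) = 0"
    by (simp add: sum_subtractf sum_unit_steps_inner_sq card_unit_steps)
  fix x :: "real^'d" assume x: "x \<in> unit_steps"
  have "(v \<bullet> x)\<^sup>2 \<le> (norm v)\<^sup>2" using power_mono[OF abs_inner_unit_step[OF x, of v], of 2] by simp
  moreover have "(norm v)\<^sup>2 / CARD('d) \<le> (norm v)\<^sup>2" by (simp add: divide_le_eq mult_le_cancel_left1)
  moreover have "(norm v)\<^sup>2 / CARD('d) \<ge> 0" by simp
  moreover have "(v \<bullet> x)\<^sup>2 \<ge> 0" by simp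
  ultimately show "\<bar>(v \<bullet> x)\<^sup>2 - (norm v)\<^sup>2 / CARD('d)\<bar> \<le> (norm v)\<^sup>2" by linarith
qed

section \<open>Characteristic functions of the walk\<close>

text \<open>\<open>\<beta>\<close> is the loss from changing the scale by one time unit, and 1/(2N
  sqrt(N+1)) is the gain from the drift. They cancel up to N^(-5/2), one order in N better than
  either alone.\<close>

lemma inverse_sqrt_diff_bounds:
  fixes N :: real
  assumes "N \<ge> 1"
  defines "\<beta> \<equiv> 1 / sqrt N - 1 / sqrt (N + 1)"
  shows "0 \<le> \<beta>" "\<beta> \<le> 1 / (2 * (N * sqrt N))"
    "\<bar>1 / (2 * N * sqrt (N + 1)) - \<beta>\<bar> \<le> 1 / (N\<^sup>2 * sqrt N)"
proof -
  define a where "a = sqrt N"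
  define b where "b = sqrt (N + 1)"
  have a: "a > 0" "N = a\<^sup>2" and b: "b\<^sup>2 = a\<^sup>2 + 1" "b > a"
    using assms by (auto simp: a_def b_def)
  have b0: "b > 0" "a + b > 0" using a b by linarith+
  \<comment> \<open>The relation b^2 - a^2 = 1 turns each difference of roots into a
    reciprocal.\<close>
  have ba: "b - a = 1 / (a + b)"
    using a b b0 by (simp add: field_simps power2_eq_square)
  have "\<beta> = (b - a) / (a * b)"
    unfolding \<beta>_def a_def[symmetric] b_def[symmetric] using a(1) b0 by (simp add: field_simps)
  then have \<beta>: "\<beta> = 1 / (a * b * (a + b))" unfolding ba by simp
  then show "0 \<le> \<beta>" using a b0 by simp
  have "2 * (a\<^sup>2 * a) = a * a * (a + a)" by (simp add: power2_eq_square)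
  also have "\<dots> \<le> a * b * (a + b)"
    using a b b0 by (intro mult_mono add_mono) auto
  finally show "\<beta> \<le> 1 / (2 * (N * sqrt N))"
    unfolding \<beta> a_def[symmetric] a(2) using a(1) b0 by (intro divide_left_mono) auto
  have "1 / (2 * a\<^sup>2 * b) - \<beta> = (b - a) / (2 * a\<^sup>2 * b * (a + b))"
    unfolding \<beta> using a(1) b0 by (simp add: divide_simps) (simp add: algebra_simps power2_eq_square)
  also have "\<dots> = 1 / (2 * a\<^sup>2 * b * (a + b)\<^sup>2)"
    unfolding ba by (simp add: power2_eq_square)
  finally have eq: "1 / (2 * a\<^sup>2 * b) - \<beta> = 1 / (2 * a\<^sup>2 * b * (a + b)\<^sup>2)" .
  have "(a\<^sup>2)\<^sup>2 * a = 1 * a\<^sup>2 * a * a\<^sup>2" by (simp add: power2_eq_square)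
  also have "\<dots> \<le> 2 * a\<^sup>2 * b * (a + b)\<^sup>2"
    using a b b0 by (intro mult_mono power_mono) auto
  finally have "1 / (2 * a\<^sup>2 * b * (a + b)\<^sup>2) \<le> 1 / ((a\<^sup>2)\<^sup>2 * a)"
    using a(1) b0 by (intro divide_left_mono) auto
  moreover have "0 \<le> 1 / (2 * a\<^sup>2 * b * (a + b)\<^sup>2)" using a(1) b0 by simp
  ultimately have "\<bar>1 / (2 * a\<^sup>2 * b) - \<beta>\<bar> \<le> 1 / ((a\<^sup>2)\<^sup>2 * a)" unfolding eq by linarith
  then show "\<bar>1 / (2 * N * sqrt (N + 1)) - \<beta>\<bar> \<le> 1 / (N\<^sup>2 * sqrt N)"
    unfolding a(2)[symmetric] unfolding a_def b_def .
qed

text \<open>The lower bound on exp(-y) is its tangent at 0; the upper one combines exp y \<ge> 1 + y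
  with (1 - y + y^2)(1 + y) = 1 + y^3 \<ge> 1.\<close>

lemma abs_exp_minus_linear_le:
  fixes y :: real
  assumes "y \<ge> 0"
  shows "\<bar>1 - y - exp (- y)\<bar> \<le> y\<^sup>2"
proof -
  have "1 - y \<le> exp (- y)" using exp_ge_add_one_self[of "- y"] by simp
  moreover have "exp (- y) \<le> 1 - y + y\<^sup>2"
  proof -
    have "exp (- y) = 1 / exp y" by (simp add: exp_minus field_simps)
    also have "\<dots> \<le> 1 / (1 + y)"
      using assms exp_ge_add_one_self[of y] by (intro divide_left_mono) auto
    also have "\<dots> \<le> 1 - y + y\<^sup>2"
    proof -
      have "(1 - y + y\<^sup>2) * (1 + y) = 1 + y ^ 3" by (simp add: algebra_simps power2_eq_square power3_eq_cube)
      then show ?thesis using assms by (simp add: pos_divide_le_eq)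
    qed
    finally show ?thesis .
  qed
  ultimately show ?thesis by linarith
qed

section \<open>Second-order expansion of the conditional characteristic function\<close>

lemma abs_inner_sum_list_le:
  fixes v :: "real^'d::finite"
  assumes "set xs \<subseteq> unit_steps"
  shows "\<bar>v \<bullet> sum_list xs\<bar> \<le> norm v * length xs"
  using assms
proof (induction xs)
  case (Cons x xs)
  then have "\<bar>v \<bullet> x\<bar> \<le> norm v" by (intro abs_inner_unit_step) auto
  with Cons show ?case by (auto simp: inner_add_right algebra_simps)
qed simp

lemma next_step_mean_inner:
  "next_step_mean xs (\<lambda>x. v \<bullet> x) = (v \<bullet> sum_list xs) / (2 * real (length xs))"
  by (simp add: next_step_mean_def sum_unit_steps_inner inner_sum_list)

text \<open>The fresh half and the repeated half each carry |v|^2/(2d), the latter up to the axis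
  defect.\<close>

lemma next_step_mean_inner_sq:
  fixes v :: "real^'d::finite"
  assumes "xs \<noteq> []"
  shows "next_step_mean xs (\<lambda>x. (v \<bullet> x)\<^sup>2) = axis_defect v xs / (2 * real (length xs)) + (norm v)\<^sup>2 / CARD('d)"
proof -
  have "(\<Sum>x\<leftarrow>xs. (v \<bullet> x)\<^sup>2) = axis_defect v xs + real (length xs) * ((norm v)\<^sup>2 / CARD('d))"
    by (induction xs) (auto simp: axis_defect_def algebra_simps add_divide_distrib)
  then show ?thesis
    using assms by (simp add: next_step_mean_def sum_unit_steps_inner_sq field_simps)
qed

text \<open>The exponent is the increment of v.S_n / sqrt n over one time unit. Expanding to second
  order leaves five errors: the cubic remainder, the mean, the deviation of the second moment from
  |v|^2/(dn), the linearization of the exponential, and the replacement of 1/n by the increment of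
  ln.\<close>

lemma one_step_char_estimate:
  fixes v :: "real^'d::finite"
  assumes xs: "set xs \<subseteq> unit_steps" "length xs = n" and n: "n \<ge> 1" and v: "norm v \<le> 1"
  defines "N \<equiv> real n"
  shows "cmod (next_step_mean xs (\<lambda>x. iexp ((v \<bullet> x) / sqrt (N + 1) - (v \<bullet> sum_list xs) * (1 / sqrt N - 1 / sqrt (N + 1))))
      - exp (- ((norm v)\<^sup>2 * (ln (N + 1) - ln N)) / (2 * CARD('d))))
    \<le> 6 * norm v / (N * sqrt N) + \<bar>axis_defect v xs\<bar> / N\<^sup>2 + (v \<bullet> sum_list xs)\<^sup>2 / N ^ 3"
proof -
  define w where "w = norm v"
  define d where "d = real CARD('d)"
  define s where "s = v \<bullet> sum_list xs"
  define C where "C = axis_defect v xs"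
  define \<beta> where "\<beta> = 1 / sqrt N - 1 / sqrt (N + 1)"
  define b where "b = sqrt (N + 1)"
  define a where "a = sqrt N"
  define D where "D x = (v \<bullet> x) / b - s * \<beta>" for x
  define mD where "mD = next_step_mean xs D"
  define mD2 where "mD2 = next_step_mean xs (\<lambda>x. (D x)\<^sup>2)"
  define y where "y = w\<^sup>2 * (ln (N + 1) - ln N) / (2 * d)"
  have ne: "xs \<noteq> []" using xs n by auto
  have N: "N \<ge> 1" using n by (simp add: N_def)
  have d: "d \<ge> 1" using zero_less_card_finite[where 'a='d] unfolding d_def by linarith
  have w: "0 \<le> w" "w \<le> 1" using v by (auto simp: w_def)
  have a: "a \<ge> 1" "a * a = N" and b: "b\<^sup>2 = N + 1" "b \<ge> a" "b > 0"
    using N by (auto simp: a_def b_def)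
  have \<beta>: "0 \<le> \<beta>" "\<beta> \<le> 1 / (2 * (N * a))" "\<bar>1 / (2 * N * b) - \<beta>\<bar> \<le> 1 / (N\<^sup>2 * a)"
    unfolding \<beta>_def a_def b_def by (rule inverse_sqrt_diff_bounds[OF N])+
  have s: "\<bar>s\<bar> \<le> w * N"
    using abs_inner_sum_list_le[OF xs(1), of v] by (simp add: s_def w_def N_def xs)
  have N2: "1 / N\<^sup>2 \<le> 1 / (N * a)"
  proof -
    have "a * 1 \<le> a * a" using a by (intro mult_left_mono) auto
    then have "N * a \<le> N\<^sup>2" using N a by (auto simp: power2_eq_square)
    then show ?thesis using N a by (intro divide_left_mono) auto
  qed

  \<comment> \<open>The step contributes at most w/a and the change of scale at most w/(2a), so |D|
    \<le> 2w/a; then 8/6 = 4/3 and w^3 \<le> w.\<close>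
  have D3: "\<bar>D x\<bar> ^ 3 / 6 \<le> (4 / 3) * (w / (N * a))" if "x \<in> unit_steps" for x
  proof -
    have "\<bar>(v \<bullet> x) / b\<bar> \<le> w / a"
      unfolding abs_divide using abs_inner_unit_step[OF that, of v] a b
      by (intro frac_le) (auto simp: w_def)
    moreover have "\<bar>s * \<beta>\<bar> \<le> w * N * (1 / (2 * (N * a)))"
      unfolding abs_mult using s \<beta> w N by (intro mult_mono) auto
    moreover have "w * N * (1 / (2 * (N * a))) = w / (2 * a)" using N by simp
    moreover have "w / (2 * a) \<le> w / a" using w a by (intro divide_left_mono) auto
    ultimately have "\<bar>D x\<bar> \<le> 2 * (w / a)" unfolding D_def by linarith
    then have "\<bar>D x\<bar> ^ 3 \<le> (2 * (w / a)) ^ 3" by (intro power_mono) auto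
    also have "\<dots> = 8 * (w ^ 3 / (N * a))" using a(2) by (simp add: power_divide power3_eq_cube)
    also have "\<dots> \<le> 8 * (w / (N * a))"
      using w N a power_decreasing[of 1 3 w] by (intro mult_left_mono divide_right_mono) auto
    finally show ?thesis by simp
  qed
  have T1: "cmod (next_step_mean xs (\<lambda>x. iexp (D x)) - (1 + \<i> * mD - mD2 / 2)) \<le> (4 / 3) * (w / (N * a))"
  proof -
    have "next_step_mean xs (\<lambda>x. iexp (D x)) = next_step_mean xs (\<lambda>x.
        (iexp (D x) - (\<Sum>k\<le>2. (\<i> * D x) ^ k / fact k)) + ((1 + \<i> * complex_of_real (D x)) + (- 1 / 2) * complex_of_real ((D x)\<^sup>2)))"
      by (simp add: numeral_2_eq_2 power2_eq_square algebra_simps)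
    also have "\<dots> = next_step_mean xs (\<lambda>x. iexp (D x) - (\<Sum>k\<le>2. (\<i> * D x) ^ k / fact k)) + (1 + \<i> * mD - mD2 / 2)"
      unfolding next_step_mean_add next_step_mean_cmult next_step_mean_of_real next_step_mean_const[OF ne] mD_def mD2_def
      by simp
    finally have "next_step_mean xs (\<lambda>x. iexp (D x)) - (1 + \<i> * mD - mD2 / 2)
        = next_step_mean xs (\<lambda>x. iexp (D x) - (\<Sum>k\<le>2. (\<i> * D x) ^ k / fact k))" by simp
    also have "cmod \<dots> \<le> (4 / 3) * (w / (N * a))"
    proof (rule norm_next_step_mean_le[OF ne xs(1)])
      fix x :: "real^'d" assume x: "x \<in> unit_steps"
      have "cmod (iexp (D x) - (\<Sum>k\<le>2. (\<i> * D x) ^ k / fact k)) \<le> \<bar>D x\<bar> ^ 3 / 6"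
        using iexp_approx1[of "D x" 2] by (simp add: numeral_3_eq_3 fact_numeral eval_nat_numeral)
      then show "cmod (iexp (D x) - (\<Sum>k\<le>2. (\<i> * D x) ^ k / fact k)) \<le> (4 / 3) * (w / (N * a))"
        using D3[OF x] by linarith
    qed
    finally show ?thesis .
  qed
  \<comment> \<open>Drift cancellation: the gap of order N^(-5/2) is multiplied by |s| \<le>
    wN.\<close>
  have T2: "\<bar>mD\<bar> \<le> w / (N * a)"
  proof -
    have "mD = next_step_mean xs (\<lambda>x. (1 / b) * (v \<bullet> x) + - (s * \<beta>))"
      unfolding mD_def D_def by simp
    also have "\<dots> = s * (1 / (2 * N * b) - \<beta>)"
      unfolding next_step_mean_add next_step_mean_cmult next_step_mean_const[OF ne] next_step_mean_inner
      by (simp add: s_def[symmetric] xs N_def[symmetric] algebra_simps)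
    finally have "\<bar>mD\<bar> = \<bar>s\<bar> * \<bar>1 / (2 * N * b) - \<beta>\<bar>" by (simp only: abs_mult)
    also have "\<dots> \<le> w * N * (1 / (N\<^sup>2 * a))"
      using s \<beta>(3) w N by (intro mult_mono) auto
    also have "\<dots> = w / (N * a)" using N by (simp add: power2_eq_square)
    finally show ?thesis .
  qed
  have T3: "\<bar>mD2 - w\<^sup>2 / (d * N)\<bar> \<le> \<bar>C\<bar> / (2 * N\<^sup>2) + w\<^sup>2 / N\<^sup>2 + s\<^sup>2 / N ^ 3"
  proof -
    have "mD2 = next_step_mean xs (\<lambda>x. ((1 / b\<^sup>2) * (v \<bullet> x)\<^sup>2 + (- 2 * s * \<beta> / b) * (v \<bullet> x)) + (s * \<beta>)\<^sup>2)"
      unfolding mD2_def D_def by (simp add: power2_diff power_divide mult_ac diff_add_eq)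
    also have "\<dots> = (1 / (N + 1)) * (C / (2 * N) + w\<^sup>2 / d) + (- 2 * s * \<beta> / b) * (s / (2 * N)) + (s * \<beta>)\<^sup>2"
      unfolding next_step_mean_add next_step_mean_cmult next_step_mean_const[OF ne] next_step_mean_inner next_step_mean_inner_sq[OF ne]
      by (simp add: s_def[symmetric] C_def[symmetric] w_def[symmetric] d_def[symmetric] b(1) xs N_def[symmetric])
    \<comment> \<open>Three deviations are separated: axis imbalance, N + 1 in place of N, and the
      terms in s^2, where the cross term has become -s^2 \<beta>/(bN).\<close>
    finally have "mD2 - w\<^sup>2 / (d * N) = C / (2 * (N * (N + 1))) + (w\<^sup>2 / d * (1 / (N + 1)) - w\<^sup>2 / d * (1 / N)) + s\<^sup>2 * (\<beta>\<^sup>2 - \<beta> / (b * N))"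
      by (simp add: algebra_simps power2_eq_square)
    also have "\<bar>\<dots>\<bar> \<le> \<bar>C / (2 * (N * (N + 1)))\<bar> + \<bar>w\<^sup>2 / d * (1 / (N + 1)) - w\<^sup>2 / d * (1 / N)\<bar> + \<bar>s\<^sup>2 * (\<beta>\<^sup>2 - \<beta> / (b * N))\<bar>"
      by (rule order_trans[OF abs_triangle_ineq add_right_mono[OF abs_triangle_ineq]])
    also have "\<bar>C / (2 * (N * (N + 1)))\<bar> \<le> \<bar>C\<bar> / (2 * N\<^sup>2)"
      unfolding abs_divide using N by (intro divide_left_mono) (auto simp: power2_eq_square abs_mult)
    also have "\<bar>w\<^sup>2 / d * (1 / (N + 1)) - w\<^sup>2 / d * (1 / N)\<bar> \<le> w\<^sup>2 / N\<^sup>2"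
    proof -
      have "\<bar>w\<^sup>2 / d * (1 / (N + 1)) - w\<^sup>2 / d * (1 / N)\<bar> = w\<^sup>2 / (d * (N * (N + 1)))"
      proof -
        have "w\<^sup>2 / d * (1 / (N + 1)) - w\<^sup>2 / d * (1 / N) = - (w\<^sup>2 / (d * (N * (N + 1))))"
          using N d by (simp add: divide_simps) (simp add: algebra_simps)
        moreover have "w\<^sup>2 / (d * (N * (N + 1))) \<ge> 0" using N d by simp
        ultimately show ?thesis by linarith
      qed
      also have "1 * (N * N) \<le> d * (N * (N + 1))" using N d by (intro mult_mono) auto
      then have "w\<^sup>2 / (d * (N * (N + 1))) \<le> w\<^sup>2 / N\<^sup>2"
        using N d by (intro divide_left_mono) (auto simp: power2_eq_square)
      finally show ?thesis .
    qed
    also have "\<bar>s\<^sup>2 * (\<beta>\<^sup>2 - \<beta> / (b * N))\<bar> \<le> s\<^sup>2 / N ^ 3"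
    proof -
      \<comment> \<open>Both \<beta>^2 and \<beta>/(bN) lie between 0 and N^(-3), so their
        difference obeys the same bound.\<close>
      have "\<beta> \<le> 1 / (N * a)"
        using \<beta>(2) N a by (simp add: field_simps)
      then have "\<beta> * \<beta> \<le> (1 / (N * a)) * (1 / (N * a))" using \<beta> N a by (intro mult_mono) auto
      moreover have "(1 / (N * a)) * (1 / (N * a)) = 1 / N ^ 3"
        using a(2) by (simp add: power3_eq_cube mult_ac)
      ultimately have "\<beta>\<^sup>2 \<le> 1 / N ^ 3" by (simp add: power2_eq_square)
      moreover have "\<beta> / (b * N) \<le> (1 / (N * a)) / (a * N)"
        using \<open>\<beta> \<le> 1 / (N * a)\<close> \<beta> N a b by (intro frac_le mult_right_mono) auto
      moreover have "(1 / (N * a)) / (a * N) = 1 / N ^ 3"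
        using a(2) by (simp add: power3_eq_cube mult_ac)
      moreover have "\<beta>\<^sup>2 \<ge> 0" "\<beta> / (b * N) \<ge> 0" using \<beta> b N by auto
      ultimately have "\<bar>\<beta>\<^sup>2 - \<beta> / (b * N)\<bar> \<le> 1 / N ^ 3" by linarith
      then have "s\<^sup>2 * \<bar>\<beta>\<^sup>2 - \<beta> / (b * N)\<bar> \<le> s\<^sup>2 * (1 / N ^ 3)" by (intro mult_left_mono) auto
      then show ?thesis by (simp add: abs_mult)
    qed
    finally show ?thesis by linarith
  qed
  have lam: "1 / (N + 1) \<le> ln (N + 1) - ln N" "ln (N + 1) - ln N \<le> 1 / N"
    using ln_Suc_diff_bounds[OF n] by (simp_all add: N_def)
  have w2: "w\<^sup>2 \<le> w" using w by (simp add: power2_eq_square mult_left_le)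
  have y0: "0 \<le> y"
  proof -
    have "0 \<le> ln (N + 1) - ln N" using N lam(1) by (intro order_trans[OF _ lam(1)]) auto
    then show ?thesis using d by (simp add: y_def)
  qed
  have y1: "y \<le> w / N"
  proof -
    have "y \<le> w\<^sup>2 * (1 / N) / (2 * d)"
      unfolding y_def using d lam by (intro divide_right_mono mult_left_mono) auto
    also have "\<dots> \<le> w\<^sup>2 * (1 / N) / 1" using d N by (intro divide_left_mono) auto
    also have "\<dots> \<le> w / N" using w2 N by (simp add: divide_right_mono)
    finally show ?thesis .
  qed
  have T4: "\<bar>1 - y - exp (- y)\<bar> \<le> w / (N * a)"
  proof -
    have "\<bar>1 - y - exp (- y)\<bar> \<le> y\<^sup>2" using y0 by (rule abs_exp_minus_linear_le)
    also have "\<dots> \<le> (w / N)\<^sup>2" using y0 y1 by (intro power_mono) auto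
    also have "\<dots> = w\<^sup>2 * (1 / N\<^sup>2)" by (simp add: power_divide)
    also have "\<dots> \<le> w * (1 / (N * a))" using w w2 N2 N by (intro mult_mono) auto
    finally show ?thesis by simp
  qed
  have T5: "\<bar>y - w\<^sup>2 / (d * N) / 2\<bar> \<le> w / (N * a)"
  proof -
    have "1 / N - 1 / (N + 1) = 1 / (N * (N + 1))" using N by (simp add: divide_simps)
    also have "\<dots> \<le> 1 / N\<^sup>2" using N by (intro divide_left_mono) (auto simp: power2_eq_square)
    finally have "\<bar>(ln (N + 1) - ln N) - 1 / N\<bar> \<le> 1 / N\<^sup>2" using lam by linarith
    moreover have "y - w\<^sup>2 / (d * N) / 2 = w\<^sup>2 / (2 * d) * ((ln (N + 1) - ln N) - 1 / N)"
      using N d by (simp add: y_def field_simps)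
    ultimately have "\<bar>y - w\<^sup>2 / (d * N) / 2\<bar> \<le> w\<^sup>2 / (2 * d) * (1 / N\<^sup>2)"
      using d by (simp only: abs_mult) (intro mult_mono, auto)
    also have "\<dots> \<le> w * (1 / (N * a))"
    proof (intro mult_mono)
      have "w\<^sup>2 / (2 * d) \<le> w\<^sup>2 / 1" using d by (intro divide_left_mono) auto
      then show "w\<^sup>2 / (2 * d) \<le> w" using w2 by simp
    qed (use N2 w N in auto)
    finally show ?thesis by simp
  qed
  have w2N: "w\<^sup>2 / N\<^sup>2 \<le> w / (N * a)"
    using mult_mono[OF w2 N2] w N by simp
  have "cmod (next_step_mean xs (\<lambda>x. iexp (D x)) - exp (- y))
     \<le> cmod (next_step_mean xs (\<lambda>x. iexp (D x)) - (1 + \<i> * mD - mD2 / 2)) + cmod ((1 + \<i> * mD - mD2 / 2) - exp (- y))"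
    by (rule norm_diff_triangle_le) (rule order_refl)+
  also have "(1 + \<i> * mD - mD2 / 2) - complex_of_real (exp (- y)) = \<i> * mD + complex_of_real (1 - mD2 / 2 - exp (- y))"
    by simp
  also have "cmod \<dots> \<le> \<bar>mD\<bar> + \<bar>1 - mD2 / 2 - exp (- y)\<bar>"
    by (rule order_trans[OF norm_triangle_ineq]) (simp only: norm_mult norm_of_real norm_ii mult_1 order_refl)
  also have "\<bar>1 - mD2 / 2 - exp (- y)\<bar> \<le> \<bar>1 - y - exp (- y)\<bar> + \<bar>y - w\<^sup>2 / (d * N) / 2\<bar> + \<bar>mD2 - w\<^sup>2 / (d * N)\<bar> / 2"
  proof -
    have "1 - mD2 / 2 - exp (- y) = (1 - y - exp (- y)) + (y - w\<^sup>2 / (d * N) / 2) + (w\<^sup>2 / (d * N) - mD2) / 2"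
      by (simp add: diff_divide_distrib)
    also have "\<bar>\<dots>\<bar> \<le> \<bar>1 - y - exp (- y)\<bar> + \<bar>y - w\<^sup>2 / (d * N) / 2\<bar> + \<bar>(w\<^sup>2 / (d * N) - mD2) / 2\<bar>"
      by (rule order_trans[OF abs_triangle_ineq add_right_mono[OF abs_triangle_ineq]])
    also have "\<bar>(w\<^sup>2 / (d * N) - mD2) / 2\<bar> = \<bar>mD2 - w\<^sup>2 / (d * N)\<bar> / 2"
      by (simp only: abs_divide abs_minus_commute abs_numeral)
    finally show ?thesis .
  qed
  finally have sum: "cmod (next_step_mean xs (\<lambda>x. iexp (D x)) - exp (- y))
      \<le> cmod (next_step_mean xs (\<lambda>x. iexp (D x)) - (1 + \<i> * mD - mD2 / 2))
       + (\<bar>mD\<bar> + (\<bar>1 - y - exp (- y)\<bar> + \<bar>y - w\<^sup>2 / (d * N) / 2\<bar> + \<bar>mD2 - w\<^sup>2 / (d * N)\<bar> / 2))"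
    by simp
  \<comment> \<open>The multiples of W add up to 4/3 + 3 + 1/2, rounded up to 6.\<close>
  have collect: "X \<le> 6 * W + c + z" if "X \<le> t1 + (t2 + (t4 + t5 + t3 / 2))" "t1 \<le> 4 / 3 * W" "t2 \<le> W" "t3 \<le> c / 2 + u + z"
    "t4 \<le> W" "t5 \<le> W" "u \<le> W" "0 \<le> c" "0 \<le> z" "0 \<le> W" for X W c z u t1 t2 t3 t4 t5 :: real
    using that by linarith
  have T3': "\<bar>mD2 - w\<^sup>2 / (d * N)\<bar> \<le> \<bar>C\<bar> / N\<^sup>2 / 2 + w\<^sup>2 / N\<^sup>2 + s\<^sup>2 / N ^ 3"
    using T3 by (simp add: mult.commute)
  have main: "cmod (next_step_mean xs (\<lambda>x. iexp (D x)) - exp (- y))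
     \<le> 6 * (w / (N * a)) + \<bar>C\<bar> / N\<^sup>2 + s\<^sup>2 / N ^ 3"
    by (rule collect[OF sum T1 T2 T3' T4 T5 w2N]) (use N a w in auto)
  have y_eq: "- y = - ((norm v)\<^sup>2 * (ln (N + 1) - ln N)) / (2 * CARD('d))"
    by (simp add: y_def w_def d_def)
  show ?thesis
    using main unfolding y_eq D_def b_def \<beta>_def s_def C_def w_def a_def by simp
qed

text \<open>Nonnegativity of the variance. The one-step estimate contains the absolute value of the
  axis defect, whereas the moment recursion controls its square.\<close>

lemma expectation_abs_le_of_second_moment:
  fixes f :: "'a \<Rightarrow> real"
  assumes "finite (set_pmf M)" "measure_pmf.expectation M (\<lambda>x. (f x)\<^sup>2) \<le> c\<^sup>2" "c \<ge> 0"
  shows "measure_pmf.expectation M (\<lambda>x. \<bar>f x\<bar>) \<le> c"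
proof -
  have int: "integrable (measure_pmf M) g" for g :: "'a \<Rightarrow> real"
    using assms(1) by (rule integrable_measure_pmf_finite)
  have "0 \<le> measure_pmf.variance M (\<lambda>x. \<bar>f x\<bar>)" by simp
  also have "\<dots> = measure_pmf.expectation M (\<lambda>x. (f x)\<^sup>2) - (measure_pmf.expectation M (\<lambda>x. \<bar>f x\<bar>))\<^sup>2"
    by (subst measure_pmf.variance_eq) (auto intro: int)
  finally have "(measure_pmf.expectation M (\<lambda>x. \<bar>f x\<bar>))\<^sup>2 \<le> c\<^sup>2" using assms(2) by linarith
  then show ?thesis using assms(3) by (rule power2_le_imp_le)
qed

section \<open>Recursion for the characteristic functions along a fixed vector\<close>

definition scaled_char :: "real \<Rightarrow> real^'d::finite \<Rightarrow> nat \<Rightarrow> complex" where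
  "scaled_char p v n = measure_pmf.expectation (merw_steps p n) (\<lambda>xs. iexp ((v \<bullet> sum_list xs) / sqrt (real n)))"

text \<open>The phase of the past has modulus one and factors out, so the one-step estimate can
  simply be averaged. The exponent -5/4 is that of the axis defect: second moment of order n^(3/2),
  root n^(3/4), divided by n^2. The other two terms are of order n^(-3/2), and 10 = 6 + 2 +
  2.\<close>

lemma scaled_char_step:
  fixes v :: "real^'d::finite"
  assumes p: "p = (2 * real CARD('d) + 1) / (4 * real CARD('d))" and n: "n \<ge> 1" and v: "norm v \<le> 1"
  shows "cmod (scaled_char p v (Suc n)
      - complex_of_real (exp (- ((norm v)\<^sup>2 * (ln (real n + 1) - ln (real n))) / (2 * CARD('d)))) * scaled_char p v n)
    \<le> 10 * norm v * real n powr (- 5 / 4)"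
proof -
  define N where "N = real n"
  define w where "w = norm v"
  define e where "e = exp (- (w\<^sup>2 * (ln (N + 1) - ln N)) / (2 * CARD('d)))"
  define D where "D xs x = (v \<bullet> x) / sqrt (N + 1) - (v \<bullet> sum_list xs) * (1 / sqrt N - 1 / sqrt (N + 1))" for xs and x :: "real^'d"
  let ?E = "measure_pmf.expectation (merw_steps p n)"
  have N: "N \<ge> 1" using n by (simp add: N_def)
  have w: "0 \<le> w" "w \<le> 1" using v by (auto simp: w_def)
  have w2: "w\<^sup>2 \<le> w" using w by (simp add: power2_eq_square mult_left_le)
  have SucN: "real (Suc n) = N + 1" by (simp add: N_def)
  have "scaled_char p v (Suc n) = ?E (\<lambda>xs. next_step_mean xs (\<lambda>x. iexp ((v \<bullet> sum_list (xs @ [x])) / sqrt (N + 1))))"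
    unfolding scaled_char_def SucN by (rule expectation_merw_steps_Suc[OF p n])
  also have "\<dots> = ?E (\<lambda>xs. iexp ((v \<bullet> sum_list xs) / sqrt N) * next_step_mean xs (\<lambda>x. iexp (D xs x)))"
  proof -
    have "iexp ((v \<bullet> sum_list (xs @ [x])) / sqrt (N + 1)) = iexp ((v \<bullet> sum_list xs) / sqrt N) * iexp (D xs x)" for xs x
    proof -
      have "(v \<bullet> sum_list (xs @ [x])) / sqrt (N + 1) = (v \<bullet> sum_list xs) / sqrt N + D xs x"
        by (simp add: D_def inner_add_right add_divide_distrib algebra_simps)
      then show ?thesis by (simp only: of_real_add distrib_left exp_add)
    qed
    then show ?thesis by (simp only: next_step_mean_cmult)
  qed
  finally have "scaled_char p v (Suc n) - complex_of_real e * scaled_char p v n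
     = ?E (\<lambda>xs. iexp ((v \<bullet> sum_list xs) / sqrt N) * next_step_mean xs (\<lambda>x. iexp (D xs x)))
       - ?E (\<lambda>xs. complex_of_real e * iexp ((v \<bullet> sum_list xs) / sqrt N))"
    unfolding scaled_char_def N_def by simp
  also have "\<dots> = ?E (\<lambda>xs. iexp ((v \<bullet> sum_list xs) / sqrt N) * (next_step_mean xs (\<lambda>x. iexp (D xs x)) - e))"
    by (subst Bochner_Integration.integral_diff[symmetric]) (auto simp: integrable_merw_steps algebra_simps)
  also have "cmod \<dots> \<le> ?E (\<lambda>xs. cmod (iexp ((v \<bullet> sum_list xs) / sqrt N) * (next_step_mean xs (\<lambda>x. iexp (D xs x)) - e)))"
    by (rule integral_norm_bound)
  also have "\<dots> \<le> ?E (\<lambda>xs. 6 * w / (N * sqrt N) + \<bar>axis_defect v xs\<bar> / N\<^sup>2 + (v \<bullet> sum_list xs)\<^sup>2 / N ^ 3)"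
  proof (rule expectation_merw_steps_mono)
    fix xs :: "(real^'d) list" assume "set xs \<subseteq> unit_steps" "length xs = n"
    from one_step_char_estimate[OF this n v]
    show "cmod (iexp ((v \<bullet> sum_list xs) / sqrt N) * (next_step_mean xs (\<lambda>x. iexp (D xs x)) - e))
      \<le> 6 * w / (N * sqrt N) + \<bar>axis_defect v xs\<bar> / N\<^sup>2 + (v \<bullet> sum_list xs)\<^sup>2 / N ^ 3"
      unfolding norm_mult norm_exp_i_times D_def e_def N_def w_def by simp
  qed
  also have "\<dots> = 6 * w / (N * sqrt N) + ?E (\<lambda>xs. \<bar>axis_defect v xs\<bar>) / N\<^sup>2 + ?E (\<lambda>xs. (v \<bullet> sum_list xs)\<^sup>2) / N ^ 3"
    by (simp add: integrable_merw_steps)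
  also have "\<dots> \<le> 6 * (w * N powr (- 5 / 4)) + 2 * (w * N powr (- 5 / 4)) + 2 * (w * N powr (- 5 / 4))"
  proof (intro add_mono)
    have NN: "N * sqrt N = N powr (3 / 2)"
    proof -
      have "N powr (3 / 2) = N powr (1 + 1 / 2)" by simp
      also have "\<dots> = N * sqrt N" using N by (simp only: powr_add powr_one powr_half_sqrt)
      finally show ?thesis ..
    qed
    \<comment> \<open>The logarithm is traded for a power; any final exponent below -1 keeps the
      errors summable.\<close>
    have ln: "1 + ln N \<le> 2 * sqrt N"
    proof -
      have "ln (sqrt N) \<le> sqrt N - 1" using N by (intro ln_le_minus_one) auto
      then show ?thesis using N by (simp add: ln_sqrt)
    qed
    have NlnN: "N * (1 + ln N) \<le> 2 * N powr (3 / 2)"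
      using mult_left_mono[OF ln, of N] N by (simp add: NN[symmetric])
    have less: "N powr (- 3 / 2) \<le> N powr (- 5 / 4)" using N by (intro powr_mono) auto
    have "6 * w / (N * sqrt N) = 6 * (w * N powr (- 3 / 2))"
      unfolding NN by (simp add: powr_minus field_simps)
    also have "\<dots> \<le> 6 * (w * N powr (- 5 / 4))" using less w by (intro mult_left_mono) auto
    finally show "6 * w / (N * sqrt N) \<le> 6 * (w * N powr (- 5 / 4))" .
    have "?E (\<lambda>xs. \<bar>axis_defect v xs\<bar>) \<le> 2 * (w\<^sup>2 * N powr (3 / 4))"
    proof (rule expectation_abs_le_of_second_moment[OF merw_steps_finite])
      have "?E (\<lambda>xs. (axis_defect v xs)\<^sup>2) \<le> (w\<^sup>2)\<^sup>2 * (N * (1 + ln N))"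
        unfolding N_def w_def by (rule second_moment_axis_defect[OF p n])
      \<comment> \<open>The factor 2 is relaxed to 4 to obtain a perfect square.\<close>
      also have "\<dots> \<le> (w\<^sup>2)\<^sup>2 * (4 * N powr (3 / 2))"
        using NlnN by (intro mult_left_mono order_trans[OF NlnN]) auto
      also have "N powr (3 / 2) = (N powr (3 / 4))\<^sup>2"
        by (simp add: power2_eq_square powr_add[symmetric])
      finally show "?E (\<lambda>xs. (axis_defect v xs)\<^sup>2) \<le> (2 * (w\<^sup>2 * N powr (3 / 4)))\<^sup>2"
        by (simp add: power_mult_distrib)
    qed simp
    also have "\<dots> \<le> 2 * (w * N powr (3 / 4))" using w2 by (intro mult_left_mono mult_right_mono) auto
    finally have "?E (\<lambda>xs. \<bar>axis_defect v xs\<bar>) / N\<^sup>2 \<le> 2 * (w * N powr (3 / 4)) / N\<^sup>2"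
      by (rule divide_right_mono) simp
    also have "\<dots> = 2 * (w * (N powr (3 / 4) / N powr 2))" using N by simp
    also have "N powr (3 / 4) / N powr 2 = N powr (- 5 / 4)" unfolding powr_diff[symmetric] by simp
    finally show "?E (\<lambda>xs. \<bar>axis_defect v xs\<bar>) / N\<^sup>2 \<le> 2 * (w * N powr (- 5 / 4))" .
    have "?E (\<lambda>xs. (v \<bullet> sum_list xs)\<^sup>2) \<le> w\<^sup>2 * (N * (1 + ln N))"
      unfolding N_def w_def by (rule second_moment_position[OF p n])
    also have "\<dots> \<le> w * (2 * N powr (3 / 2))" using w N by (intro mult_mono[OF w2 NlnN]) auto
    finally have "?E (\<lambda>xs. (v \<bullet> sum_list xs)\<^sup>2) / N ^ 3 \<le> w * (2 * N powr (3 / 2)) / N ^ 3"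
      using N by (intro divide_right_mono) auto
    also have "\<dots> = 2 * (w * (N powr (3 / 2) / N powr 3))" using N by simp
    also have "N powr (3 / 2) / N powr 3 = N powr (- 3 / 2)" unfolding powr_diff[symmetric] by simp
    also have "2 * (w * N powr (- 3 / 2)) \<le> 2 * (w * N powr (- 5 / 4))" using less w by (intro mult_left_mono) auto
    finally show "?E (\<lambda>xs. (v \<bullet> sum_list xs)\<^sup>2) / N ^ 3 \<le> 2 * (w * N powr (- 5 / 4))" .
  qed
  finally show ?thesis by (simp add: e_def N_def w_def)
qed

text \<open>The damping factors are at most 1, so earlier errors are never amplified and simply add
  up, while the exponents telescope from ln 1 = 0 to ln n.\<close>

lemma scaled_char_estimate:
  fixes v :: "real^'d::finite"
  assumes p: "p = (2 * real CARD('d) + 1) / (4 * real CARD('d))" and n: "n \<ge> 1" and v: "norm v \<le> 1"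
  shows "cmod (scaled_char p v n - exp (- ((norm v)\<^sup>2 * ln (real n)) / (2 * CARD('d))))
    \<le> norm v * (1 + 10 * (\<Sum>k<n. real k powr (- 5 / 4)))"
  using n
proof (induction n rule: dec_induct)
  case base
  have "scaled_char p v (Suc 0) - 1 = (\<Sum>x\<in>unit_steps. iexp (v \<bullet> x) - 1) /\<^sub>R (2 * real CARD('d))"
  proof -
    have "(\<Sum>x\<in>unit_steps. iexp (v \<bullet> x) - 1) = (\<Sum>x\<in>unit_steps. iexp (v \<bullet> x)) - (2 * real CARD('d)) *\<^sub>R 1"
      by (simp add: sum_subtractf card_unit_steps scaleR_conv_of_real)
    then have "(\<Sum>x\<in>unit_steps. iexp (v \<bullet> x) - 1) /\<^sub>R (2 * real CARD('d))
        = (\<Sum>x\<in>unit_steps. iexp (v \<bullet> x)) /\<^sub>R (2 * real CARD('d)) - 1"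
      by (simp only: scaleR_diff_right) simp
    then show ?thesis
      unfolding scaled_char_def expectation_merw_steps_1 by simp
  qed
  also have "cmod \<dots> = cmod (\<Sum>x\<in>unit_steps. iexp (v \<bullet> x) - 1) / (2 * real CARD('d))"
    unfolding norm_scaleR by (simp add: field_simps)
  also have "\<dots> \<le> (\<Sum>x\<in>(unit_steps :: (real^'d) set). norm v) / (2 * real CARD('d))"
  proof (intro divide_right_mono sum_norm_le)
    fix x :: "real^'d" assume "x \<in> unit_steps"
    then show "cmod (iexp (v \<bullet> x) - 1) \<le> norm v"
      using iexp_approx1[of "v \<bullet> x" 0] abs_inner_unit_step[of x v] by simp
  qed simp
  also have "\<dots> = norm v" by (simp add: card_unit_steps)
  \<comment> \<open>The sum over k < 1 is the single term \<open>0 powr (- 5 / 4)\<close>, which is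
    0 by convention.\<close>
  finally show ?case by simp
next
  case (step n)
  have n: "n \<ge> 1" using step by simp
  define q where "q = exp (- ((norm v)\<^sup>2 * (ln (real n + 1) - ln (real n))) / (2 * CARD('d)))"
  define a where "a = exp (- ((norm v)\<^sup>2 * ln (real n)) / (2 * CARD('d)))"
  have qa: "exp (- ((norm v)\<^sup>2 * ln (real (Suc n))) / (2 * CARD('d))) = q * a"
    unfolding q_def a_def exp_add[symmetric] by (simp add: add.commute field_simps)
  have q: "0 \<le> q" "q \<le> 1"
  proof -
    have "ln (real n) \<le> ln (real n + 1)" using n by simp
    then show "q \<le> 1" unfolding q_def by (simp add: divide_nonpos_nonneg)
  qed (simp add: q_def)
  have "scaled_char p v (Suc n) - q * a = (scaled_char p v (Suc n) - q * scaled_char p v n) + q * (scaled_char p v n - a)"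
    by (simp add: algebra_simps)
  also have "cmod \<dots> \<le> cmod (scaled_char p v (Suc n) - q * scaled_char p v n) + q * cmod (scaled_char p v n - a)"
    by (rule order_trans[OF norm_triangle_ineq]) (simp add: norm_mult q)
  also have "\<dots> \<le> 10 * norm v * real n powr (- 5 / 4) + 1 * (norm v * (1 + 10 * (\<Sum>k<n. real k powr (- 5 / 4))))"
    using scaled_char_step[OF p n v] step.IH q unfolding q_def[symmetric] a_def[symmetric]
    by (intro add_mono mult_mono) auto
  finally show ?case unfolding qa by (simp add: algebra_simps)
qed

section \<open>Passage to the limit and tightness\<close>

lemma merw_pos_char:
  fixes u :: "real^'d::finite"
  assumes "n \<ge> 2"
  shows "(\<integral>x. iexp (u \<bullet> x) \<partial>measure_pmf (map_pmf (\<lambda>s. (1 / sqrt (real n * ln (real n))) *\<^sub>R s) (merw_pos p n)))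
    = scaled_char p (u /\<^sub>R sqrt (ln (real n))) n"
  unfolding scaled_char_def merw_pos_def integral_map_pmf
  using assms by (simp add: real_sqrt_mult field_simps)

lemma merw_pos_char_tendsto:
  fixes u :: "real^'d::finite"
  assumes p: "p = (2 * real CARD('d) + 1) / (4 * real CARD('d))"
  shows "(\<lambda>n. \<integral>x. iexp (u \<bullet> x) \<partial>measure_pmf (map_pmf (\<lambda>s. (1 / sqrt (real n * ln (real n))) *\<^sub>R s) (merw_pos p n)))
     \<longlonglongrightarrow> complex_of_real (exp (- (norm u)\<^sup>2 / (2 * CARD('d))))" (is "?f \<longlonglongrightarrow> ?L")
proof (rule LIM_zero_cancel, rule Lim_null_comparison)
  \<comment> \<open>\<open>K\<close> contains the whole series, so the bound does not depend on
    \<open>n\<close>.\<close>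
  define K where "K = 1 + 10 * (\<Sum>k. real k powr (- 5 / 4))"
  have sm: "summable (\<lambda>k. real k powr (- 5 / 4))" by (simp add: summable_real_powr_iff)
  have ln_top: "filterlim (\<lambda>n. sqrt (ln (real n))) at_top sequentially"
    by (intro filterlim_compose[OF sqrt_at_top] filterlim_compose[OF ln_at_top] filterlim_real_sequentially)
  \<comment> \<open>Puts u / sqrt (ln n) in the unit ball, where the estimate for fixed v is
    available.\<close>
  have ev1: "\<forall>\<^sub>F n in sequentially. sqrt (ln (real n)) \<ge> max 1 (norm u)"
    using ln_top by (simp only: filterlim_at_top)
  show "\<forall>\<^sub>F n in sequentially. norm (?f n - ?L) \<le> norm u * K / sqrt (ln (real n))"
    using ev1 eventually_ge_at_top[of 2]
  proof eventually_elim
    case (elim n)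
    define r where "r = sqrt (ln (real n))"
    have r: "r \<ge> 1" "norm u \<le> r" using elim by (auto simp: r_def)
    have r2: "r\<^sup>2 = ln (real n)" using elim by (simp add: r_def)
    define v where "v = u /\<^sub>R r"
    have nv: "norm v = norm u / r" using r by (simp add: v_def divide_inverse_commute)
    have v1: "norm v \<le> 1" using r by (simp add: nv)
    \<comment> \<open>The rescaling makes the Gaussian factor equal to the limit for every such
      \<open>n\<close>, so only the error term, proportional to |v|, has to vanish.\<close>
    have "(norm v)\<^sup>2 * ln (real n) = (norm u)\<^sup>2"
      unfolding nv r2[symmetric] using r by (simp add: power_divide)
    then have "norm (?f n - ?L) = cmod (scaled_char p v n - exp (- ((norm v)\<^sup>2 * ln (real n)) / (2 * CARD('d))))"
      unfolding merw_pos_char[OF elim(2)] by (simp only: v_def r_def)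
    also have "\<dots> \<le> norm v * (1 + 10 * (\<Sum>k<n. real k powr (- 5 / 4)))"
      using elim by (intro scaled_char_estimate[OF p _ v1]) auto
    also have "\<dots> \<le> norm v * K"
      unfolding K_def using sum_le_suminf[OF sm, of "{..<n}"] by (intro mult_left_mono add_left_mono) auto
    finally show ?case by (simp add: nv r_def)
  qed
  show "(\<lambda>n. norm u * K / sqrt (ln (real n))) \<longlonglongrightarrow> 0"
    using ln_top by (intro tendsto_divide_0[OF tendsto_const] filterlim_at_top_imp_at_infinity)
qed

text \<open>Chebyshev's inequality, with the second moments of the d coordinates added: their scaled
  sum is at most d(1 + ln n)/ln n.\<close>

lemma merw_pos_tight:
  assumes p: "p = (2 * real CARD('d::finite) + 1) / (4 * real CARD('d))" and e: "e > 0"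
  defines "M \<equiv> (\<lambda>n. measure_pmf (map_pmf (\<lambda>s. (1 / sqrt (real n * ln (real n))) *\<^sub>R s) (merw_pos p n :: (real^'d) pmf)))"
  shows "\<exists>R. \<forall>\<^sub>F n in sequentially. measure (M n) {x \<in> space (M n). norm x > R} \<le> e"
proof (intro exI)
  \<comment> \<open>Chosen so that 2d/R^2 = e, where 2d bounds the scaled second moment once ln n
    \<ge> 1.\<close>
  define R where "R = sqrt (2 * CARD('d) / e)"
  have R2: "R\<^sup>2 = 2 * CARD('d) / e" and R: "R > 0" using e by (auto simp: R_def)
  show "\<forall>\<^sub>F n in sequentially. measure (M n) {x \<in> space (M n). norm x > R} \<le> e"
    using eventually_ge_at_top[of 3]
  proof eventually_elim
    case (elim n)
    define c where "c = 1 / sqrt (real n * ln (real n))"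
    \<comment> \<open>Holds from n = 3 on because exp 1 \<le> 3; it gives (1 + ln n)/ln n \<le>
      2.\<close>
    have ln1: "ln (real n) \<ge> 1"
    proof -
      have "exp 1 \<le> real n" using exp_le elim by linarith
      then show ?thesis using elim by (subst ln_ge_iff) auto
    qed
    have c2: "c\<^sup>2 = 1 / (real n * ln (real n))" using ln1 by (simp add: c_def power_divide)
    let ?E = "measure_pmf.expectation (merw_steps p n :: (real^'d) list pmf)"
    have int: "integrable (measure_pmf (merw_steps p n :: (real^'d) list pmf)) f" for f :: "_ \<Rightarrow> real"
      by (rule integrable_merw_steps)
    have "measure (M n) {x \<in> space (M n). norm x > R} = measure_pmf.expectation (map_pmf (\<lambda>s. c *\<^sub>R s) (merw_pos p n :: (real^'d) pmf)) (indicator {x. norm x > R})"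
      unfolding M_def c_def[symmetric] by simp
    also have "\<dots> = ?E (\<lambda>xs. indicator {x. norm x > R} (c *\<^sub>R sum_list xs))"
      unfolding merw_pos_def integral_map_pmf ..
    also have "\<dots> \<le> ?E (\<lambda>xs. (norm (c *\<^sub>R sum_list xs))\<^sup>2 / R\<^sup>2)"
    proof (rule integral_mono[OF int int])
      fix xs :: "(real^'d) list"
      show "indicator {x. norm x > R} (c *\<^sub>R sum_list xs) \<le> (norm (c *\<^sub>R sum_list xs))\<^sup>2 / R\<^sup>2"
      proof (cases "norm (c *\<^sub>R sum_list xs) > R")
        case True
        then have "R\<^sup>2 \<le> (norm (c *\<^sub>R sum_list xs))\<^sup>2" using R by (intro power_mono) auto
        then show ?thesis using True R by (simp add: indicator_def)
      qed (simp add: indicator_def)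
    qed
    also have "\<dots> = c\<^sup>2 / R\<^sup>2 * (\<Sum>b\<in>Basis. ?E (\<lambda>xs. (b \<bullet> sum_list xs)\<^sup>2))"
    proof -
      have "(norm (c *\<^sub>R x))\<^sup>2 / R\<^sup>2 = c\<^sup>2 / R\<^sup>2 * (\<Sum>b\<in>Basis. (b \<bullet> x)\<^sup>2)" for x :: "real^'d"
      proof -
        have "(norm x)\<^sup>2 = (\<Sum>b\<in>Basis. (b \<bullet> x)\<^sup>2)"
          unfolding power2_norm_eq_inner euclidean_inner[of x x] by (simp add: power2_eq_square inner_commute)
        then show ?thesis by (simp add: power_mult_distrib)
      qed
      then have "?E (\<lambda>xs. (norm (c *\<^sub>R sum_list xs))\<^sup>2 / R\<^sup>2)
          = ?E (\<lambda>xs. c\<^sup>2 / R\<^sup>2 * (\<Sum>b\<in>Basis. (b \<bullet> sum_list xs)\<^sup>2))"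
        by (simp only:)
      also have "\<dots> = c\<^sup>2 / R\<^sup>2 * (\<Sum>b\<in>Basis. ?E (\<lambda>xs. (b \<bullet> sum_list xs)\<^sup>2))"
        by (subst Bochner_Integration.integral_mult_right_zero, subst Bochner_Integration.integral_sum[OF int]) simp
      finally show ?thesis .
    qed
    also have "\<dots> \<le> c\<^sup>2 / R\<^sup>2 * (\<Sum>b\<in>(Basis :: (real^'d) set). real n * (1 + ln (real n)))"
    proof (intro mult_left_mono sum_mono)
      fix b :: "real^'d" assume "b \<in> Basis"
      then show "?E (\<lambda>xs. (b \<bullet> sum_list xs)\<^sup>2) \<le> real n * (1 + ln (real n))"
        using second_moment_position[OF p, of n b] elim by simp
    qed simp
    also have "\<dots> = (1 + ln (real n)) / ln (real n) * (e / 2)"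
      unfolding R2 c2 using elim ln1 e by (simp add: field_simps)
    also have "\<dots> \<le> 2 * (e / 2)"
      using ln1 e by (intro mult_right_mono) (auto simp: field_simps)
    finally show ?case by simp
  qed
qed

theorem theorem3p6:
  fixes p :: real
  assumes "p = (2 * real CARD('d::finite) + 1) / (4 * real CARD('d))"
  shows "conv_distr
           (\<lambda>n. measure_pmf (map_pmf (\<lambda>s. (1 / sqrt (real n * ln (real n))) *\<^sub>R s)
                                  (merw_pos p n :: (real^'d) pmf)))
           (gauss_iso (sqrt (1 / real CARD('d))))"
proof (rule levy_continuity_tight)
  let ?N = "gauss_iso (sqrt (1 / real CARD('d))) :: (real^'d) measure"
  show "prob_space ?N" by (rule prob_space_gauss_iso) simp
  show "(\<lambda>x. x) \<in> ?N \<rightarrow>\<^sub>M borel"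
    by (simp add: gauss_iso_def)
  fix u :: "real^'d"
  have "(\<integral>x. iexp (u \<bullet> x) \<partial>?N) = complex_of_real (exp (- (norm u)\<^sup>2 / (2 * CARD('d))))"
    by (subst char_gauss_iso) (simp_all add: field_simps)
  then show "(\<lambda>n. \<integral>x. iexp (u \<bullet> x) \<partial>measure_pmf (map_pmf (\<lambda>s. (1 / sqrt (real n * ln (real n))) *\<^sub>R s) (merw_pos p n)))
     \<longlonglongrightarrow> (\<integral>x. iexp (u \<bullet> x) \<partial>?N)"
    using merw_pos_char_tendsto[OF assms, of u] by (simp only:)
qed (use merw_pos_tight[OF assms] in \<open>auto intro: prob_space_measure_pmf\<close>)

end
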